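(* Let $K\subset\mathbb{R}^n$ be compact convex with $o\in{\rm int}\,K$, and let $\sigma_1,\ldots,\sigma_k\subset[n]$ form an $s$-uniform cover of $[n]$ for $s\ge1$. Then equality holds in the inequality $$|K|^s\ \geq\ \frac{\prod_{i=1}^k|\sigma_i|!}{(n!)^s}\cdot\prod_{i=1}^k|K\cap E_{\sigma_i}|$$ if and only if $K={\rm conv}\{K\cap E_{\tilde\sigma_i}\}_{i=1}^l$, where $\tilde\sigma_1,\ldots,\tilde\sigma_l$ is the $1$-uniform cover of $[n]$ induced by $\sigma_1,\ldots,\sigma_k$.
   Context: $o$ is the origin, $e_1,\ldots,e_n$ is a fixed orthonormal basis of $\mathbb{R}^n$, and $[n]=\{1,\ldots,n\}$. For a non-empty $\sigma\subset[n]$, $E_\sigma={\rm lin}\{e_i\}_{i\in\sigma}$ is the linear span, and $|\sigma|$ is the cardinality of $\sigma$. For a compact set $M$ whose affine hull has dimension $m$, $|M|$ denotes its $m$-dimensional Lebesgue measure. ${\rm conv}\{M_i\}_{i=1}^l$ is the convex hull of $\bigcup_i M_i$. For an integer $s\ge1$, the not necessarily distinct proper non-empty subsets $\sigma_1,\ldots,\sigma_k\subset[n]$ form an $s$-uniform cover of $[n]$ if each $j\in[n]$ is contained in exactly $s$ of $\sigma_1,\ldots,\sigma_k$. The $1$-uniform cover induced by $\sigma_1,\ldots,\sigma_k$ consists of all non-empty distinct subsets $\tilde\sigma_1,\ldots,\tilde\sigma_l$ of $[n]$ of the form $\bigcap_{i=1}^k\sigma_i^{\varepsilon(i)}$ with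 $\varepsilon(i)\in\{0,1\}$, where $\sigma_i^0=\sigma_i$ and $\sigma_i^1=[n]\setminus\sigma_i$; it is a partition of $[n]$. The displayed inequality is a theorem of Liakopoulos. *)

theory Defs
  imports "HOL-Analysis.Analysis"
begin

definition orthonormal_frame :: "'a::euclidean_space set \<Rightarrow> 'a \<Rightarrow> 'a set \<Rightarrow> bool" where
  "orthonormal_frame A p B \<longleftrightarrow>
     pairwise orthogonal B \<and> (\<forall>b\<in>B. norm b = 1) \<and> A = (\<lambda>v. p + v) ` span B"

(* Same construction as that of lborel from Basis; a measure on the whole space that is
   concentrated on p + span B. *)
definition flat_measure :: "'a::euclidean_space \<Rightarrow> 'a set \<Rightarrow> 'a measure" where
  "flat_measure p B =
     distr (\<Pi>\<^sub>M b\<in>B. (lborel :: real measure)) borel (\<lambda>f. p + (\<Sum>b\<in>B. f b *\<^sub>R b))"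

(* The m-dimensional Lebesgue measure of M, where m is the dimension of the affine hull of M:
   this is card B for every frame B of the affine hull. Every non-empty affine set has a frame,
   and Lebesgue measure on R^m is invariant under isometries, so the chosen frame is irrelevant.
   Only meant for Borel (in particular, compact) M. *)
definition vol :: "'a::euclidean_space set \<Rightarrow> real" where
  "vol M = (let (p, B) = (SOME (p, B). orthonormal_frame (affine hull M) p B)
            in measure (flat_measure p B) M)"

definition coord_span :: "('n \<Rightarrow> 'a::euclidean_space) \<Rightarrow> 'n set \<Rightarrow> 'a set" where
  "coord_span e \<sigma> = span (e ` \<sigma>)"

(* The index type 'n plays the role of [n]. *)
definition uniform_cover :: "nat \<Rightarrow> nat \<Rightarrow> (nat \<Rightarrow> 'n::finite set) \<Rightarrow> bool" where
  "uniform_cover s k \<sigma> \<longleftrightarrow>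
     1 \<le> s \<and> (\<forall>i\<in>{1..k}. \<sigma> i \<noteq> {} \<and> \<sigma> i \<noteq> UNIV) \<and>
     (\<forall>j. card {i \<in> {1..k}. j \<in> \<sigma> i} = s)"

definition induced_cover :: "nat \<Rightarrow> (nat \<Rightarrow> 'n::finite set) \<Rightarrow> 'n set set" where
  "induced_cover k \<sigma> =
     {\<tau>. \<tau> \<noteq> {} \<and> (\<exists>\<epsilon>::nat \<Rightarrow> nat. (\<forall>i\<in>{1..k}. \<epsilon> i \<in> {0, 1}) \<and>
            \<tau> = (\<Inter>i\<in>{1..k}. if \<epsilon> i = 0 then \<sigma> i else UNIV - \<sigma> i))}"

end

theory Submission
  imports Defs "HOL-Probability.Distributions"
begin

text \<open>Let \<open>N\<close> be the gauge of \<open>K\<close>, so that \<open>m! |K \<inter> E\<^sub>\<rho>|\<close> is the integral of \<open>exp (- N)\<close> over the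
  \<open>m\<close>-dimensional coordinate subspace \<open>E\<^sub>\<rho>\<close>. By sublinearity
  \<open>\<Prod>\<^sub>i exp (- N v\<^sub>i) \<le> exp (- N (\<Sum>\<^sub>i v\<^sub>i / s)) ^ s\<close>, and integrating out one coordinate at a time
  preserves this inequality by the one-dimensional Prekopa-Leindler inequality for \<open>s\<close> functions: this
  gives the inequality of Liakopoulos. In the equality case, Prekopa-Leindler is an equality at
  every step, so one can go back from no coordinate to all of them through tuples at which the
  inequality is an equality, with one value to choose freely at each coordinate. This yields many tuples
  on which \<open>N\<close> is additive. Letting the components in a block \<open>T\<close> of the induced cover tend to
  infinity shows \<open>N (z + y) = N z + N y\<close> for all \<open>y\<close> in the span of \<open>T\<close> and \<open>z\<close> in the span of the
  remaining vectors; for all blocks together this says that \<open>K\<close> is the convex hull of its sections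
  by the blocks. Conversely, for such \<open>K\<close> the function \<open>exp (- N)\<close> is a product over the blocks.\<close>

section \<open>The one-dimensional Prekopa-Leindler inequality and its equality case\<close>

text \<open>The arithmetic-geometric mean inequality: \<open>x \<le> exp (x - 1)\<close> is applied
  to the ratios \<open>a i / m\<close> with \<open>m\<close> the mean, and the exponents then sum to
  zero.\<close>

lemma prod_le_mean_power:
  fixes a :: "'i \<Rightarrow> real"
  assumes "finite I" and pos: "\<And>i. i \<in> I \<Longrightarrow> 0 < a i"
  shows "prod a I \<le> (sum a I / card I) ^ card I"
proof (cases "I = {}")
  case False
  define m where "m = sum a I / card I"
  have m: "0 < m"
    unfolding m_def using assms False by (intro divide_pos_pos sum_pos) (auto simp: card_gt_0_iff)
  have "(\<Prod>i\<in>I. a i / m) \<le> (\<Prod>i\<in>I. exp (a i / m - 1))"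
  proof (rule prod_mono, intro conjI)
    fix i assume "i \<in> I"
    then show "0 \<le> a i / m" using pos m by (simp add: less_imp_le)
    show "a i / m \<le> exp (a i / m - 1)" using exp_ge_add_one_self[of "a i / m - 1"] by simp
  qed
  also have "\<dots> = exp (\<Sum>i\<in>I. a i / m - 1)"
    by (simp add: exp_sum[OF assms(1)])
  also have "(\<Sum>i\<in>I. a i / m - 1) = 0"
  proof -
    have "sum a I \<noteq> 0" using m unfolding m_def by auto
    then have "sum a I / m = card I" by (simp add: m_def)
    then show ?thesis by (simp add: sum_subtractf flip: sum_divide_distrib)
  qed
  finally have "prod a I / m ^ card I \<le> 1"
    by (simp add: prod_dividef)
  then show ?thesis using m unfolding m_def[symmetric] by (simp add: field_simps)
qed simp

text \<open>The inverse of the normalised distribution function \<open>H / m\<close> transports the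
  uniform density on the unit interval to \<open>g / m\<close>. Positivity of \<open>g\<close> makes
  \<open>H\<close> strictly increasing with nonzero derivative, so the inverse function theorem
  applies.\<close>

lemma quantile_function:
  fixes g :: "real \<Rightarrow> real"
  assumes cont: "continuous_on UNIV g" and pos: "\<And>t. 0 < g t" and int: "integrable lborel g"
  obtains q :: "real \<Rightarrow> real" where
    "\<And>u. u \<in> {0<..<1} \<Longrightarrow> (q has_real_derivative (\<integral>t. g t \<partial>lborel) / g (q u)) (at u)"
    "\<And>a. \<exists>u\<in>{0<..<1}. q u = a"
    "strict_mono_on {0<..<1} q"
    "0 < (\<integral>t. g t \<partial>lborel)"
proof -
  define m where "m = (\<integral>t. g t \<partial>lborel)"
  define H where "H = (\<lambda>t. integral {..t} g)"
  have iU: "g absolutely_integrable_on UNIV"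
    using int by (simp add: set_integrable_def integrable_completion)
  have iS: "g absolutely_integrable_on S" if "S \<in> sets lebesgue" for S
    using set_integrable_subset[OF iU that] by simp
  then have iS': "g integrable_on S" if "S \<in> sets lebesgue" for S
    using that set_lebesgue_integral_eq_integral(1) by blast
  have H_diff: "H b = H a + integral {a..b} g" if "a \<le> b" for a b
  proof -
    have "{..b} = {..a} \<union> {a..b}" using that by auto
    moreover have "negligible ({..a} \<inter> {a..b})"
      by (rule negligible_subset[of "{a}"]) auto
    ultimately show ?thesis unfolding H_def
      by (metis integral_Un iS' sets_completionI_sets sets_lborel atMost_borel atLeastAtMost_borel)
  qed
  have H_deriv: "(H has_real_derivative g t) (at t)" for t
  proof -
    \<comment> \<open>Starting the integral at \<open>t - 1\<close> makes \<open>t\<close> an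
      interior point of the interval, and near \<open>t\<close> the function \<open>H\<close>
      differs from this integral by a constant.\<close>
    have "((\<lambda>x. integral {t-1..x} g) has_real_derivative g t) (at t within {t-1..t+1})"
      by (rule integral_has_real_derivative) (auto intro: continuous_on_subset[OF cont])
    then have "((\<lambda>x. integral {t-1..x} g) has_real_derivative g t) (at t)"
      by (subst (asm) at_within_Icc_at) auto
    then have "((\<lambda>x. H (t-1) + integral {t-1..x} g) has_real_derivative g t) (at t)"
      by (auto intro!: derivative_eq_intros)
    then show ?thesis
    proof (rule has_field_derivative_transform_within_open[where S="{t-1<..}"])
      fix x assume "x \<in> {t-1<..}"
      then show "H (t - 1) + integral {t - 1..x} g = H x" by (subst H_diff[of "t-1" x]) auto
    qed auto
  qed
  have H_cont: "isCont H t" for t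
    using H_deriv by (rule DERIV_isCont)
  have H_mono: "H a < H b" if "a < b" for a b
    using that by (rule DERIV_pos_imp_increasing) (use H_deriv pos in blast)
  have H_eq: "H t = (\<integral>x. indicator {..t} x * g x \<partial>lborel)" for t
  proof -
    have "integrable lborel (\<lambda>x. indicator {..t} x *\<^sub>R g x)"
      using int by (intro integrable_mult_indicator) auto
    then show ?thesis
      using set_borel_integral_eq_integral(2)[of "{..t}" g]
      by (simp add: H_def set_integrable_def set_lebesgue_integral_def)
  qed
  have "(\<lambda>n. H (real n)) \<longlonglongrightarrow> (\<integral>x. g x \<partial>lborel)" unfolding H_eq
  proof (rule integral_dominated_convergence[where w=g])
    show "AE x in lborel. (\<lambda>n. indicator {..real n} x * g x) \<longlonglongrightarrow> g x"
    proof (rule AE_I2)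
      fix x
      obtain N :: nat where N: "x \<le> real N" using real_arch_simple by blast
      have "eventually (\<lambda>n. indicator {..real n} x * g x = g x) sequentially"
        using eventually_ge_at_top[of N] by eventually_elim (use N in auto)
      then show "(\<lambda>n. indicator {..real n} x * g x) \<longlonglongrightarrow> g x"
        by (rule tendsto_eventually)
    qed
  qed (use int less_imp_le[OF pos] in \<open>auto simp: indicator_def\<close>)
  then have limt: "(\<lambda>n. H (real n)) \<longlonglongrightarrow> m" by (simp add: m_def)
  have "(\<lambda>n. H (- real n)) \<longlonglongrightarrow> (\<integral>x. 0 \<partial>(lborel::real measure))" unfolding H_eq
  proof (rule integral_dominated_convergence[where w=g])
    show "AE x in lborel. (\<lambda>n. indicator {..- real n} x * g x) \<longlonglongrightarrow> 0"
    proof (rule AE_I2)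
      fix x
      obtain N :: nat where N: "- x < real N" using reals_Archimedean2 by blast
      have "eventually (\<lambda>n. indicator {..- real n} x * g x = 0) sequentially"
        using eventually_ge_at_top[of N] by eventually_elim (use N in \<open>auto simp: indicator_def\<close>)
      then show "(\<lambda>n. indicator {..- real n} x * g x) \<longlonglongrightarrow> 0"
        by (rule tendsto_eventually)
    qed
  qed (use int less_imp_le[OF pos] in \<open>auto simp: indicator_def\<close>)
  then have limb: "(\<lambda>n. H (- real n)) \<longlonglongrightarrow> 0" by simp
  have Hpos: "0 < H t" for t
  proof -
    have "0 \<le> H (t - 1)" unfolding H_eq
      by (intro integral_nonneg_AE AE_I2) (use less_imp_le[OF pos] in auto)
    then show ?thesis using H_mono[of "t-1" t] by linarith
  qed
  have Hle: "H t \<le> m" for t unfolding H_eq m_def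
  proof (rule integral_mono[OF _ int])
    show "integrable lborel (\<lambda>x. indicator {..t} x * g x)"
      using integrable_mult_indicator[OF _ int, of "{..t}"] by simp
  qed (use less_imp_le[OF pos] in \<open>auto simp: indicator_def\<close>)
  have Hlt: "H t < m" for t
    using Hle[of "t+1"] H_mono[of t "t+1"] by linarith
  have m: "0 < m" using Hpos[of 0] Hlt[of 0] by linarith
  have H_surj: "\<exists>t. H t = y" if y: "0 < y" "y < m" for y
  proof -
    obtain n1 where n1: "y < H (real n1)"
      using order_tendstoD(1)[OF limt y(2)] eventually_happens by force
    obtain n2 where n2: "H (- real n2) < y"
      using order_tendstoD(2)[OF limb y(1)] eventually_happens by force
    have "\<exists>t\<ge>- real n2. t \<le> real n1 \<and> H t = y"
      by (rule IVT) (use n1 n2 H_cont in auto)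
    then show ?thesis by blast
  qed
  have H_inj: "inj H" 
    by (rule linorder_injI) (metis H_mono less_irrefl)
  \<comment> \<open>The range of \<open>H\<close> is the open interval from \<open>0\<close> to
    \<open>m\<close>, so \<open>q\<close> inverts \<open>H / m\<close> precisely on the open unit
    interval.\<close>
  define q where "q u = inv H (m * u)" for u
  have Hq: "H (q u) = m * u" if "u \<in> {0<..<1}" for u
  proof -
    have "\<exists>t. H t = m * u" using that m by (intro H_surj) auto
    then show ?thesis unfolding q_def by (metis f_inv_into_f rangeI)
  qed
  have qH: "q (H t / m) = t" for t
    unfolding q_def using m H_inj by simp
  have Hm: "H t / m \<in> {0<..<1}" for t
    using Hpos Hlt m by auto
  have qm: "strict_mono_on {0<..<1} q"
  proof (rule strict_mono_onI)
    fix r s :: real assume "r \<in> {0<..<1}" "s \<in> {0<..<1}" "r < s"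
    then have "H (q r) < H (q s)" using m by (simp add: Hq)
    then show "q r < q s" using H_mono[of "q s" "q r"] by (cases "q s" "q r" rule: linorder_cases) auto
  qed
  have qd: "(q has_real_derivative m / g (q u)) (at u)" if u: "u \<in> {0<..<1}" for u
  proof -
    have "((\<lambda>t. H t / m) has_real_derivative g (q u) / m) (at (q u))"
      by (rule DERIV_cdivide[OF H_deriv])
    then have "(q has_derivative (*) (m / g (q u))) (at (H (q u) / m))"
      unfolding has_field_derivative_def
      by (rule has_derivative_inverse_strong[where S=UNIV and f="\<lambda>t. H t / m", rotated 4])
         (use m pos[of "q u"] qH H_cont in \<open>auto simp: fun_eq_iff continuous_on_eq_continuous_at intro!: continuous_intros\<close>)
    moreover have "H (q u) / m = u" using m by (simp add: Hq[OF u])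
    ultimately show ?thesis by (simp add: has_field_derivative_def)
  qed
  show ?thesis
    by (rule that[of q]) (use qd qm m Hm qH in \<open>auto simp flip: m_def intro!: bexI[of _ "H _ / m"]\<close>)
qed

text \<open>The last assertion: since the quantile maps are onto, a tight tuple can be found with any
  prescribed value of a partial sum of its entries.\<close>

lemma
  fixes g :: "'i \<Rightarrow> real \<Rightarrow> real" and G :: "real \<Rightarrow> real"
  assumes I: "finite I" "I \<noteq> {}"
    and g_cont: "\<And>i. i \<in> I \<Longrightarrow> continuous_on UNIV (g i)"
    and g_pos: "\<And>i t. i \<in> I \<Longrightarrow> 0 < g i t"
    and g_int: "\<And>i. i \<in> I \<Longrightarrow> integrable lborel (g i)"
    and G_cont: "continuous_on UNIV G"
    and G_pos: "\<And>t. 0 < G t"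
    and G_int: "integrable lborel G"
    and C: "0 < C"
    and le: "\<And>t. C * (\<Prod>i\<in>I. g i (t i)) \<le> G ((\<Sum>i\<in>I. t i) / card I) ^ card I"
  shows Prekopa_Leindler_real:
      "C * (\<Prod>i\<in>I. \<integral>t. g i t \<partial>lborel) \<le> (\<integral>t. G t \<partial>lborel) ^ card I"
    and Prekopa_Leindler_real_equality:
      "\<lbrakk>C * (\<Prod>i\<in>I. \<integral>t. g i t \<partial>lborel) = (\<integral>t. G t \<partial>lborel) ^ card I; S \<subseteq> I; S \<noteq> {}\<rbrakk>
        \<Longrightarrow> \<exists>t. (\<Sum>i\<in>S. t i) = a \<and>
              C * (\<Prod>i\<in>I. g i (t i)) = G ((\<Sum>i\<in>I. t i) / card I) ^ card I"
proof -
  define m where "m i = (\<integral>t. g i t \<partial>lborel)" for i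
  define n where "n = card I"
  have n: "0 < n" using I by (simp add: n_def card_gt_0_iff)
  have "\<exists>q. (\<forall>u\<in>{0<..<1}. (q has_real_derivative m i / g i (q u)) (at u)) \<and>
            (\<forall>a. \<exists>u\<in>{0<..<1}. q u = a) \<and> strict_mono_on {0<..<1} q \<and> 0 < m i" if "i \<in> I" for i
    using quantile_function[OF g_cont[OF that] g_pos[OF that] g_int[OF that]] unfolding m_def by metis
  then obtain q where
    q_deriv: "\<And>i u. i \<in> I \<Longrightarrow> u \<in> {0<..<1} \<Longrightarrow> (q i has_real_derivative m i / g i (q i u)) (at u)"
    and q_surj: "\<And>i a. i \<in> I \<Longrightarrow> \<exists>u\<in>{0<..<1}. q i u = a"
    and q_mono: "\<And>i. i \<in> I \<Longrightarrow> strict_mono_on {0<..<1} (q i)"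
    and m_pos: "\<And>i. i \<in> I \<Longrightarrow> 0 < m i"
    by metis
  have q_cont: "continuous_on {0<..<1} (q i)" if "i \<in> I" for i
    using q_deriv[OF that] by (intro DERIV_continuous_on) (auto intro: has_field_derivative_at_within)
  have q_less: "q i u < q i v" if "i \<in> I" "u < v" "u \<in> {0<..<1}" "v \<in> {0<..<1}" for i u v
    using strict_mono_onD[OF q_mono[OF that(1)]] that by blast

  \<comment> \<open>Each \<open>q i\<close> attains \<open>a / card S\<close> at some
    \<open>w i\<close>. At the least of these parameters the partial sum is at most
    \<open>a\<close>, at the greatest at least \<open>a\<close>; the intermediate value theorem does
    the rest.\<close>
  have sum_surj: "\<exists>u\<in>{0<..<1}. (\<Sum>i\<in>S. q i u) = a" if S: "S \<subseteq> I" "S \<noteq> {}" for S a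
  proof -
    have fS: "finite S" using S I finite_subset by blast
    have "\<forall>i\<in>I. \<exists>w. w \<in> {0<..<1} \<and> q i w = a / card S"
      using q_surj by blast
    then obtain w where w: "\<And>i. i \<in> I \<Longrightarrow> w i \<in> {0<..<1} \<and> q i (w i) = a / card S"
      unfolding bchoice_iff by blast
    define lo hi where "lo = Min (w ` S)" and "hi = Max (w ` S)"
    have "lo \<in> w ` S" "hi \<in> w ` S" using fS S(2) by (auto simp: lo_def hi_def)
    then have lohi: "lo \<in> {0<..<1}" "hi \<in> {0<..<1}" using w S(1) by auto
    have bnd: "lo \<le> w i" "w i \<le> hi" if "i \<in> S" for i
      using that fS by (auto simp: lo_def hi_def)
    have "lo \<le> hi" using \<open>lo \<in> w ` S\<close> bnd by auto
    have 1: "(\<Sum>i\<in>S. q i lo) \<le> a"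
    proof -
      have "(\<Sum>i\<in>S. q i lo) \<le> (\<Sum>i\<in>S. a / card S)"
      proof (rule sum_mono)
        fix i assume i: "i \<in> S"
        show "q i lo \<le> a / card S"
          using q_less[of i lo "w i"] w[of i] lohi i S(1) bnd(1)[OF i] by (cases "lo = w i") auto
      qed
      then show ?thesis using fS S(2) by simp
    qed
    have 2: "a \<le> (\<Sum>i\<in>S. q i hi)"
    proof -
      have "(\<Sum>i\<in>S. a / card S) \<le> (\<Sum>i\<in>S. q i hi)"
      proof (rule sum_mono)
        fix i assume i: "i \<in> S"
        show "a / card S \<le> q i hi"
          using q_less[of i "w i" hi] w[of i] lohi i S(1) bnd(2)[OF i] by (cases "hi = w i") auto
      qed
      then show ?thesis using fS S(2) by simp
    qed
    have sub: "{lo..hi} \<subseteq> {0<..<1}" using lohi by auto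
    have "continuous_on {lo..hi} (\<lambda>u. \<Sum>i\<in>S. q i u)"
      using S(1) q_cont continuous_on_subset[OF _ sub] by (intro continuous_on_sum) blast
    then have "\<exists>u\<ge>lo. u \<le> hi \<and> (\<Sum>i\<in>S. q i u) = a"
      by (intro IVT' 1 2 \<open>lo \<le> hi\<close>)
    then show ?thesis using sub by auto
  qed

  define Q where "Q u = (\<Sum>i\<in>I. q i u) / n" for u
  define Q' where "Q' u = (\<Sum>i\<in>I. m i / g i (q i u)) / n" for u
  have Q_deriv: "(Q has_real_derivative Q' u) (at u)" if "u \<in> {0<..<1}" for u
    unfolding Q_def Q'_def by (intro DERIV_cdivide DERIV_sum q_deriv that)
  have Q_inj: "inj_on Q {0<..<1}"
  proof (rule strict_mono_on_imp_inj_on, rule strict_mono_onI)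
    fix u v :: real assume "u \<in> {0<..<1}" "v \<in> {0<..<1}" "u < v"
    then have "(\<Sum>i\<in>I. q i u) < (\<Sum>i\<in>I. q i v)"
      using I by (intro sum_strict_mono) (auto intro: q_less)
    then show "Q u < Q v" using n by (simp add: Q_def divide_strict_right_mono)
  qed
  have Q_image: "Q ` {0<..<1} = UNIV"
  proof -
    have "a \<in> Q ` {0<..<1}" for a
      using sum_surj[OF order_refl I(2), of "n * a"] n by (auto simp: Q_def image_iff intro!: bexI)
    then show ?thesis by blast
  qed
  have Q'_pos: "0 < Q' u" for u
    unfolding Q'_def using n I m_pos g_pos by (intro divide_pos_pos sum_pos) auto
  \<comment> \<open>\<open>h\<close> is the integrand after substituting the mean \<open>Q\<close>
    of the quantile functions into the integral of \<open>G\<close>. It will be bounded below by the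
    constant \<kappa>, whose \<open>n\<close>-th power is the left-hand side of the
    inequality.\<close>
  define h where "h u = Q' u * G (Q u)" for u
  define \<kappa> where "\<kappa> = root n (C * (\<Prod>i\<in>I. m i))"
  have Cm_pos: "0 < C * (\<Prod>i\<in>I. m i)"
    using C m_pos by (simp add: prod_pos)
  have \<kappa>: "\<kappa> ^ n = C * (\<Prod>i\<in>I. m i)" "0 < \<kappa>"
    using Cm_pos n by (simp_all add: \<kappa>_def)
  have amgm: "(\<Prod>i\<in>I. m i / g i (q i u)) \<le> Q' u ^ n" for u
    unfolding Q'_def n_def using m_pos g_pos by (intro prod_le_mean_power I) simp
  have le': "C * (\<Prod>i\<in>I. g i (q i u)) \<le> G (Q u) ^ n" for u
    using le[of "\<lambda>i. q i u"] by (simp add: Q_def n_def)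
  have split: "C * (\<Prod>i\<in>I. m i) = (C * (\<Prod>i\<in>I. g i (q i u))) * (\<Prod>i\<in>I. m i / g i (q i u))" for u
  proof -
    have "(\<Prod>i\<in>I. m i) = (\<Prod>i\<in>I. g i (q i u) * (m i / g i (q i u)))"
      using g_pos by (intro prod.cong) (auto simp: less_imp_neq[symmetric])
    then show ?thesis by (simp only: prod.distrib mult.assoc)
  qed
  have prods_pos: "0 < (\<Prod>i\<in>I. m i / g i (q i u))" "0 < C * (\<Prod>i\<in>I. g i (q i u))" for u
    using C m_pos g_pos by (simp_all add: prod_pos)
  \<comment> \<open>The hypothesis at the tuple of quantiles is multiplied by the mean inequality
    for their derivatives \<open>m i / g i (q i u)\<close>; the factors \<open>g i (q i u)\<close>
    cancel.\<close>
  have h_ge: "\<kappa> \<le> h u" for u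
  proof -
    have "\<kappa> ^ n \<le> h u ^ n"
      unfolding \<kappa> split[of u] h_def power_mult_distrib mult.commute[of "Q' u ^ n"]
      by (intro mult_mono le' amgm less_imp_le[OF prods_pos(1)] less_imp_le[OF zero_less_power[OF G_pos]])
    then show ?thesis
      by (rule power_le_imp_le_base[of _ "n - 1", unfolded Suc_diff_1[OF n]])
         (use Q'_pos G_pos in \<open>auto simp: h_def intro!: mult_nonneg_nonneg less_imp_le\<close>)
  qed
  have h_integral: "h integrable_on {0<..<1}" "integral {0<..<1} h = (\<integral>t. G t \<partial>lborel)"
  proof -
    have "G absolutely_integrable_on UNIV"
      using G_int by (simp add: set_integrable_def integrable_completion)
    moreover have "integral UNIV G = (\<integral>t. G t \<partial>lborel)"
      using G_int by (rule integral_lborel)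
    ultimately have "(\<lambda>x. \<bar>Q' x\<bar> * G (Q x)) absolutely_integrable_on {0<..<1} \<and>
        integral {0<..<1} (\<lambda>x. \<bar>Q' x\<bar> * G (Q x)) = (\<integral>t. G t \<partial>lborel)"
      by (subst has_absolute_integral_change_of_variables_1')
         (use Q_inj Q_image Q_deriv in \<open>auto intro: has_field_derivative_at_within\<close>)
    moreover have "(\<lambda>x. \<bar>Q' x\<bar> * G (Q x)) = h"
      using Q'_pos by (auto simp: h_def less_imp_le)
    ultimately show "h integrable_on {0<..<1}" "integral {0<..<1} h = (\<integral>t. G t \<partial>lborel)"
      using set_lebesgue_integral_eq_integral(1) by auto
  qed
  have const_integral: "((\<lambda>_. \<kappa>) has_integral \<kappa>) {0<..<1::real}"
    using has_integral_const_real[of \<kappa> 0 1] by (simp add: has_integral_Icc_iff_Ioo)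
  have ge: "\<kappa> \<le> (\<integral>t. G t \<partial>lborel)"
    using has_integral_le[OF const_integral integrable_integral[OF h_integral(1)]] h_ge h_integral(2) by simp
  then show "C * (\<Prod>i\<in>I. \<integral>t. g i t \<partial>lborel) \<le> (\<integral>t. G t \<partial>lborel) ^ card I"
    using power_mono[OF ge, of n] \<kappa> by (simp add: m_def n_def)

  assume eq: "C * (\<Prod>i\<in>I. \<integral>t. g i t \<partial>lborel) = (\<integral>t. G t \<partial>lborel) ^ card I"
    and S: "S \<subseteq> I" "S \<noteq> {}"
  \<comment> \<open>From here on \<open>h - \<kappa>\<close> is nonnegative and continuous with
    integral zero, hence vanishes on the whole open interval.\<close>
  have "\<kappa> = (\<integral>t. G t \<partial>lborel)"
    using eq \<kappa> ge n power_eq_iff_eq_base[of n \<kappa> "\<integral>t. G t \<partial>lborel"] by (simp add: m_def n_def)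
  then have h0: "((\<lambda>u. h u - \<kappa>) has_integral 0) {0<..<1}"
    using has_integral_diff[OF integrable_integral[OF h_integral(1)] const_integral] h_integral(2) by simp
  have h_cont: "continuous_on {0<..<1} h"
    unfolding h_def Q'_def Q_def
    using g_pos n by (intro continuous_intros q_cont continuous_on_compose2[OF G_cont]
          continuous_on_compose2[OF g_cont]) (auto simp: less_imp_neq[symmetric])
  have h_eq: "h u = \<kappa>" if u: "u \<in> {0<..<1}" for u
  proof -
    \<comment> \<open>Continuity of \<open>h\<close> is available on the open interval, while the
      vanishing criterion wants a compact one around \<open>u\<close>.\<close>
    have sub: "cbox (u/2) ((u+1)/2) \<subseteq> {0<..<1}" using u by auto
    have int: "(\<lambda>u. h u - \<kappa>) integrable_on cbox (u/2) ((u+1)/2)"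
      by (intro integrable_continuous continuous_intros continuous_on_subset[OF h_cont sub])
    have "integral (cbox (u/2) ((u+1)/2)) (\<lambda>u. h u - \<kappa>) \<le> 0"
      using integral_subset_le[OF sub int has_integral_integrable[OF h0]] h_ge integral_unique[OF h0] by simp
    moreover have "0 \<le> integral (cbox (u/2) ((u+1)/2)) (\<lambda>u. h u - \<kappa>)"
      using h_ge by (intro integral_nonneg int) simp
    ultimately have "((\<lambda>u. h u - \<kappa>) has_integral 0) (cbox (u/2) ((u+1)/2))"
      using integrable_integral[OF int] by simp
    then have "h u - \<kappa> = 0"
      by (rule has_integral_0_cbox_imp_0[rotated 2])
         (use h_ge u in \<open>auto intro!: continuous_on_diff continuous_on_const continuous_on_subset[OF h_cont]\<close>)
    then show ?thesis by simp
  qed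
  obtain u where u: "u \<in> {0<..<1}" "(\<Sum>i\<in>S. q i u) = a" using sum_surj[OF S] by blast
  \<comment> \<open>Strict inequality here, multiplied by the mean inequality, would make
    \<open>h u\<close> exceed \<kappa>. So every tuple of quantiles with a common parameter is
    tight, and \<open>u\<close> selects one with the prescribed partial sum.\<close>
  have "C * (\<Prod>i\<in>I. g i (q i u)) = G (Q u) ^ n"
  proof (rule ccontr)
    assume "C * (\<Prod>i\<in>I. g i (q i u)) \<noteq> G (Q u) ^ n"
    then have lt: "C * (\<Prod>i\<in>I. g i (q i u)) < G (Q u) ^ n" using le'[of u] by simp
    have "\<kappa> ^ n < G (Q u) ^ n * Q' u ^ n"
      unfolding \<kappa> split[of u]
      by (intro mult_less_le_imp_less lt amgm prods_pos less_imp_le[OF prods_pos(2)])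
    then show False using h_eq[OF u(1)] by (simp add: h_def power_mult_distrib[symmetric] mult.commute)
  qed
  then show "\<exists>t. (\<Sum>i\<in>S. t i) = a \<and>
      C * (\<Prod>i\<in>I. g i (t i)) = G ((\<Sum>i\<in>I. t i) / card I) ^ card I"
    using u by (intro exI[of _ "\<lambda>i. q i u"]) (simp add: Q_def n_def)
qed

section \<open>Integration over flats\<close>

interpretation lborel_prod: product_sigma_finite "\<lambda>_. lborel :: real measure"
  by standard

text \<open>For an orthonormal \<open>B\<close> this is the Lebesgue integral over
  \<open>span B\<close>. Values in \<open>ennreal\<close> allow Tonelli's theorem without
  integrability conditions.\<close>

definition frame_integral :: "'a::euclidean_space set \<Rightarrow> ('a \<Rightarrow> ennreal) \<Rightarrow> ennreal" where
  "frame_integral B f = (\<integral>\<^sup>+ \<omega>. f (\<Sum>b\<in>B. \<omega> b *\<^sub>R b) \<partial>PiM B (\<lambda>_. lborel))"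

lemma measurable_frame_sum [measurable]:
  "(\<lambda>\<omega>. \<Sum>b\<in>B. \<omega> b *\<^sub>R b) \<in> PiM B (\<lambda>_. lborel) \<rightarrow>\<^sub>M (borel :: 'a::euclidean_space measure)"
  by measurable

lemma frame_sum_in_span: "(\<Sum>b\<in>B. \<omega> b *\<^sub>R b) \<in> span B"
  by (intro span_sum span_scale span_base)

lemma frame_integral_cong:
  "(\<And>x. x \<in> span B \<Longrightarrow> f x = g x) \<Longrightarrow> frame_integral B f = frame_integral B g"
  unfolding frame_integral_def by (intro nn_integral_cong) (simp add: frame_sum_in_span)

lemma frame_integral_mono:
  "(\<And>x. x \<in> span B \<Longrightarrow> f x \<le> g x) \<Longrightarrow> frame_integral B f \<le> frame_integral B g"
  unfolding frame_integral_def by (intro nn_integral_mono) (simp add: frame_sum_in_span)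

lemma frame_integral_cmult:
  assumes [measurable]: "f \<in> borel_measurable borel"
  shows "frame_integral B (\<lambda>x. c * f x) = c * frame_integral B f"
  unfolding frame_integral_def by (rule nn_integral_cmult) measurable

lemma frame_integral_multc:
  assumes "f \<in> borel_measurable borel"
  shows "frame_integral B (\<lambda>x. f x * c) = frame_integral B f * c"
  using frame_integral_cmult[OF assms] by (simp add: mult.commute)

lemma frame_integral_empty [simp]: "frame_integral {} f = f 0"
  by (simp add: frame_integral_def PiM_empty nn_integral_count_space_finite)

lemma frame_integral_measurable:
  assumes "finite B" and [measurable]: "(\<lambda>(v, x). h v x) \<in> borel_measurable (M \<Otimes>\<^sub>M borel)"
  shows "(\<lambda>v. frame_integral B (h v)) \<in> borel_measurable M"
proof -
  interpret sigma_finite_measure "PiM B (\<lambda>_. lborel :: real measure)"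
    by (rule lborel_prod.sigma_finite) fact
  show ?thesis unfolding frame_integral_def by measurable
qed

lemma frame_integral_swap:
  assumes "finite B" and M: "sigma_finite_measure M"
    and [measurable]: "(\<lambda>(v, x). h v x) \<in> borel_measurable (M \<Otimes>\<^sub>M borel)"
  shows "frame_integral B (\<lambda>x. \<integral>\<^sup>+v. h v x \<partial>M) = (\<integral>\<^sup>+v. frame_integral B (h v) \<partial>M)"
proof -
  interpret pair_sigma_finite M "PiM B (\<lambda>_. lborel :: real measure)"
    using M lborel_prod.sigma_finite[OF \<open>finite B\<close>] by (rule pair_sigma_finite.intro)
  show ?thesis unfolding frame_integral_def by (rule Fubini') measurable
qed

lemma frame_integral_swap':
  assumes "finite B" "finite B'"
    and [measurable]: "(\<lambda>(y, x). h y x) \<in> borel_measurable (borel \<Otimes>\<^sub>M borel)"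
  shows "frame_integral B (\<lambda>x. frame_integral B' (\<lambda>y. h y x)) =
         frame_integral B' (\<lambda>y. frame_integral B (\<lambda>x. h y x))"
  unfolding frame_integral_def[of B']
  by (rule frame_integral_swap) (use assms(1,2) in \<open>auto intro: lborel_prod.sigma_finite\<close>)

lemma frame_integral_insert:
  assumes "finite B" "b \<notin> B" and [measurable]: "f \<in> borel_measurable borel"
  shows "frame_integral (insert b B) f =
         (\<integral>\<^sup>+t. frame_integral B (\<lambda>x. f (x + t *\<^sub>R b)) \<partial>lborel)"
proof -
  have *: "(\<Sum>c\<in>insert b B. (if c = b then t else \<omega> c) *\<^sub>R c) = (\<Sum>c\<in>B. \<omega> c *\<^sub>R c) + t *\<^sub>R b" for \<omega> t
  proof -
    have "(\<Sum>c\<in>B. (if c = b then t else \<omega> c) *\<^sub>R c) = (\<Sum>c\<in>B. \<omega> c *\<^sub>R c)"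
      using assms(2) by (intro sum.cong) auto
    then show ?thesis using assms(1,2) by (simp add: add.commute)
  qed
  show ?thesis unfolding frame_integral_def
    by (subst lborel_prod.product_nn_integral_insert_rev) (use assms(1,2) in \<open>auto simp: * fun_upd_def\<close>)
qed

text \<open>By induction on the frame: \<open>v\<close> is a multiple of \<open>b\<close> plus a
  vector of \<open>span B\<close>. The multiple is absorbed by a shift of the one-dimensional
  integral, the rest by the induction hypothesis.\<close>

lemma frame_integral_translate:
  assumes "finite B" "f \<in> borel_measurable borel" "v \<in> span B"
  shows "frame_integral B (\<lambda>x. f (x + v)) = frame_integral B f"
  using assms
proof (induction B arbitrary: f v rule: finite_induct)
  case (insert b B)
  note [measurable] = insert.prems(1)
  obtain k where k: "v - k *\<^sub>R b \<in> span B"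
    using insert.prems(2) span_breakdown_eq by blast
  have [measurable]: "(\<lambda>t. frame_integral B (\<lambda>x. f (x + t *\<^sub>R b))) \<in> borel_measurable borel"
    using insert.hyps(1) by (rule frame_integral_measurable) measurable
  have "frame_integral (insert b B) (\<lambda>x. f (x + v)) =
        (\<integral>\<^sup>+t. frame_integral B (\<lambda>x. f (x + t *\<^sub>R b + v)) \<partial>lborel)"
    using insert.hyps by (subst frame_integral_insert) auto
  also have "\<dots> = (\<integral>\<^sup>+t. frame_integral B (\<lambda>x. f (x + (k + 1 * t) *\<^sub>R b)) \<partial>lborel)"
  proof (rule nn_integral_cong)
    fix t
    have "frame_integral B (\<lambda>x. f (x + t *\<^sub>R b + v)) =
        frame_integral B (\<lambda>x. f ((x + (v - k *\<^sub>R b)) + (k + 1 * t) *\<^sub>R b))"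
      by (simp add: algebra_simps)
    also have "\<dots> = frame_integral B (\<lambda>x. f (x + (k + 1 * t) *\<^sub>R b))"
      using insert.IH[OF _ k, of "\<lambda>x. f (x + (k + 1 * t) *\<^sub>R b)"] by simp
    finally show "frame_integral B (\<lambda>x. f (x + t *\<^sub>R b + v)) = \<dots>" .
  qed
  also have "\<dots> = (\<integral>\<^sup>+t. frame_integral B (\<lambda>x. f (x + t *\<^sub>R b)) \<partial>lborel)"
    by (subst nn_integral_real_affine[of _ 1 k]) auto
  also have "\<dots> = frame_integral (insert b B) f"
    using insert.hyps by (simp add: frame_integral_insert)
  finally show ?case .
qed simp

lemma frame_integral_scale:
  assumes "finite B" "f \<in> borel_measurable borel" "0 < r"
  shows "frame_integral B f = ennreal (r ^ card B) * frame_integral B (\<lambda>x. f (r *\<^sub>R x))"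
  using assms(1,2)
proof (induction B arbitrary: f rule: finite_induct)
  case (insert b B)
  note [measurable] = insert.prems(1)
  have [measurable]: "(\<lambda>t. frame_integral B (\<lambda>x. f (x + t *\<^sub>R b))) \<in> borel_measurable borel"
    "(\<lambda>t. frame_integral B (\<lambda>x. f (r *\<^sub>R (x + t *\<^sub>R b)))) \<in> borel_measurable borel"
    using insert.hyps(1) by (rule frame_integral_measurable, measurable)+
  have "frame_integral (insert b B) f = (\<integral>\<^sup>+t. frame_integral B (\<lambda>x. f (x + t *\<^sub>R b)) \<partial>lborel)"
    using insert.hyps by (simp add: frame_integral_insert)
  also have "\<dots> = ennreal r * (\<integral>\<^sup>+t. frame_integral B (\<lambda>x. f (x + (r * t) *\<^sub>R b)) \<partial>lborel)"
    using assms(3) by (subst nn_integral_real_affine[of _ r 0]) auto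
  also have "(\<integral>\<^sup>+t. frame_integral B (\<lambda>x. f (x + (r * t) *\<^sub>R b)) \<partial>lborel) =
      (\<integral>\<^sup>+t. ennreal (r ^ card B) * frame_integral B (\<lambda>x. f (r *\<^sub>R (x + t *\<^sub>R b))) \<partial>lborel)"
    by (intro nn_integral_cong, subst insert.IH) (auto simp: algebra_simps)
  also have "\<dots> = ennreal (r ^ card B) * frame_integral (insert b B) (\<lambda>x. f (r *\<^sub>R x))"
    using insert.hyps by (simp add: nn_integral_cmult frame_integral_insert)
  finally show ?case
    using insert.hyps assms(3) by (simp add: ennreal_mult mult.assoc)
qed simp

lemma frame_integral_Un:
  assumes "finite Q" "finite R" "Q \<inter> R = {}" "f \<in> borel_measurable borel"
  shows "frame_integral (Q \<union> R) f = frame_integral Q (\<lambda>y. frame_integral R (\<lambda>x. f (x + y)))"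
  using assms(1,3,4)
proof (induction Q arbitrary: f rule: finite_induct)
  case (insert b Q)
  note [measurable] = insert.prems(2)
  have [measurable]: "(\<lambda>y. frame_integral R (\<lambda>x. f (x + y))) \<in> borel_measurable borel"
    using assms(2) by (rule frame_integral_measurable) measurable
  have "frame_integral (insert b Q \<union> R) f =
      (\<integral>\<^sup>+t. frame_integral (Q \<union> R) (\<lambda>x. f (x + t *\<^sub>R b)) \<partial>lborel)"
    using insert.hyps insert.prems assms(2) by (simp add: frame_integral_insert)
  also have "\<dots> = (\<integral>\<^sup>+t. frame_integral Q (\<lambda>y. frame_integral R (\<lambda>x. f (x + (y + t *\<^sub>R b)))) \<partial>lborel)"
    using insert.prems by (intro nn_integral_cong, subst insert.IH) (auto simp: add.assoc)
  also have "\<dots> = frame_integral (insert b Q) (\<lambda>y. frame_integral R (\<lambda>x. f (x + y)))"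
    using insert.hyps by (simp add: frame_integral_insert)
  finally show ?case .
qed simp

section \<open>Orthonormal frames, Gaussian integrals and volume\<close>

definition orthonormal :: "'a::euclidean_space set \<Rightarrow> bool" where
  "orthonormal B \<longleftrightarrow> pairwise orthogonal B \<and> (\<forall>b\<in>B. norm b = 1)"

lemma orthonormal_independent: "orthonormal B \<Longrightarrow> independent B"
  unfolding orthonormal_def by (rule pairwise_orthogonal_independent) auto

lemma orthonormal_finite: "orthonormal B \<Longrightarrow> finite B"
  using orthonormal_independent independent_imp_finite by blast

lemma orthonormal_mono: "orthonormal B \<Longrightarrow> R \<subseteq> B \<Longrightarrow> orthonormal R"
  using pairwise_subset unfolding orthonormal_def by blast

lemma norm_frame_sum:
  assumes "orthonormal B"
  shows "(norm (\<Sum>b\<in>B. \<omega> b *\<^sub>R b))\<^sup>2 = (\<Sum>b\<in>B. (\<omega> b)\<^sup>2)"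
proof -
  have "(norm (\<Sum>b\<in>B. \<omega> b *\<^sub>R b))\<^sup>2 = (\<Sum>b\<in>B. (norm (\<omega> b *\<^sub>R b))\<^sup>2)"
    using assms orthonormal_finite[OF assms]
    by (intro norm_sum_Pythagorean) (auto simp: orthonormal_def pairwise_def orthogonal_clauses)
  then show ?thesis using assms by (simp add: orthonormal_def)
qed

text \<open>By Pythagoras the Gaussian is a product over the coordinates, so its total mass depends
  on the frame only through its cardinality.\<close>

lemma frame_integral_gaussian:
  assumes "orthonormal B"
  shows "frame_integral B (\<lambda>x. ennreal (exp (- (norm x)\<^sup>2))) =
         (\<integral>\<^sup>+t. ennreal (exp (- t\<^sup>2)) \<partial>lborel) ^ card B"
proof -
  have fin: "finite B" using assms by (rule orthonormal_finite)
  have "frame_integral B (\<lambda>x. ennreal (exp (- (norm x)\<^sup>2))) =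
        (\<integral>\<^sup>+ \<omega>. (\<Prod>b\<in>B. ennreal (exp (- (\<omega> b)\<^sup>2))) \<partial>PiM B (\<lambda>_. lborel))"
    unfolding frame_integral_def norm_frame_sum[OF assms]
    by (intro nn_integral_cong) (simp add: prod_ennreal exp_sum[OF fin] flip: sum_negf)
  also have "\<dots> = (\<integral>\<^sup>+t. ennreal (exp (- t\<^sup>2)) \<partial>lborel) ^ card B"
    using fin by (subst lborel_prod.product_nn_integral_prod) auto
  finally show ?thesis .
qed

lemma nn_integral_gaussian:
  "0 < (\<integral>\<^sup>+t. ennreal (exp (- t\<^sup>2)) \<partial>(lborel::real measure))"
  "(\<integral>\<^sup>+t. ennreal (exp (- t\<^sup>2)) \<partial>(lborel::real measure)) < \<infinity>"
proof -
  have "has_bochner_integral lborel (\<lambda>x::real. exp (- x\<^sup>2)) (sqrt pi)"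
    using has_bochner_integral_even_function[OF gaussian_moment_0] by simp
  then have "(\<integral>\<^sup>+t. ennreal (exp (- t\<^sup>2)) \<partial>(lborel::real measure)) = ennreal (sqrt pi)"
    by (intro nn_integral_eq_integral[THEN trans]) (auto simp: has_bochner_integral_iff)
  then show "0 < (\<integral>\<^sup>+t. ennreal (exp (- t\<^sup>2)) \<partial>(lborel::real measure))"
     "(\<integral>\<^sup>+t. ennreal (exp (- t\<^sup>2)) \<partial>(lborel::real measure)) < \<infinity>" by auto
qed

lemma frame_integral_gaussian_bounds:
  assumes "orthonormal B"
  shows "0 < frame_integral B (\<lambda>x. ennreal (exp (- (norm x)\<^sup>2)))"
    and "frame_integral B (\<lambda>x. ennreal (exp (- (norm x)\<^sup>2))) < \<infinity>"
  using nn_integral_gaussian frame_integral_gaussian[OF assms]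
  by (metis power_not_zero zero_less_iff_neq_zero, metis infinity_ennreal_def power_less_top_ennreal)

text \<open>Translation-invariant measures are proportional, by Fubini against a Gaussian weight; the
  total mass of the Gaussian is the same in both frames, because the frames have equally many vectors.\<close>

lemma frame_integral_frame_irrelevant:
  assumes B: "orthonormal B" "orthonormal B'" "span B = span B'"
    and [measurable]: "f \<in> borel_measurable borel"
  shows "frame_integral B f = frame_integral B' f"
proof -
  have fin: "finite B" "finite B'" using B by (auto intro: orthonormal_finite)
  have card: "card B = card B'"
    using B by (metis dim_span dim_eq_card_independent orthonormal_independent)
  define g :: "'a \<Rightarrow> ennreal" where "g x = ennreal (exp (- (norm x)\<^sup>2))" for x
  have [measurable]: "g \<in> borel_measurable borel" unfolding g_def by measurable
  define c where "c = frame_integral B g"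
  have c': "frame_integral B' g = c"
    unfolding c_def g_def using B card by (simp add: frame_integral_gaussian)
  have c: "0 < c" "c < \<infinity>"
    unfolding c_def g_def by (rule frame_integral_gaussian_bounds[OF B(1)])+
  have "frame_integral B f * c = frame_integral B (\<lambda>x. f x * frame_integral B' (\<lambda>y. g (y + - x)))"
    unfolding frame_integral_multc[OF assms(4), symmetric]
    by (rule frame_integral_cong, subst frame_integral_translate)
       (use fin B c' in \<open>auto intro: span_neg\<close>)
  also have "\<dots> = frame_integral B (\<lambda>x. frame_integral B' (\<lambda>y. f x * g (y - x)))"
    by (subst frame_integral_cmult) auto
  also have "\<dots> = frame_integral B' (\<lambda>y. frame_integral B (\<lambda>x. f x * g (y - x)))"
    using fin by (rule frame_integral_swap') measurable
  \<comment> \<open>Here \<open>x\<close> is replaced by \<open>x + y\<close>, and the Gaussian is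
    even.\<close>
  also have "\<dots> = frame_integral B' (\<lambda>y. frame_integral B (\<lambda>x. f (x + y) * g x))"
  proof (rule frame_integral_cong)
    fix y assume "y \<in> span B'"
    then have "frame_integral B (\<lambda>x. f (x + y) * g (y - (x + y))) = frame_integral B (\<lambda>x. f x * g (y - x))"
      using fin B by (intro frame_integral_translate[where f="\<lambda>x. f x * g (y - x)"]) auto
    moreover have "g (y - (x + y)) = g x" for x by (simp add: g_def)
    ultimately show "frame_integral B (\<lambda>x. f x * g (y - x)) = frame_integral B (\<lambda>x. f (x + y) * g x)"
      by simp
  qed
  also have "\<dots> = frame_integral B (\<lambda>x. frame_integral B' (\<lambda>y. f (x + y) * g x))"
    using fin(2,1) by (rule frame_integral_swap') measurable
  also have "\<dots> = frame_integral B (\<lambda>x. frame_integral B' f * g x)"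
  proof (rule frame_integral_cong)
    fix x assume "x \<in> span B"
    then have "frame_integral B' (\<lambda>y. f (y + x)) = frame_integral B' f"
      using fin B by (intro frame_integral_translate) auto
    then show "frame_integral B' (\<lambda>y. f (x + y) * g x) = frame_integral B' f * g x"
      by (subst frame_integral_multc) (auto simp: add.commute)
  qed
  also have "\<dots> = frame_integral B' f * c"
    unfolding c_def by (rule frame_integral_cmult) measurable
  finally show ?thesis
    using c by (metis ennreal_mult_divide_eq infinity_ennreal_def less_irrefl)
qed

text \<open>The frame in \<open>vol\<close> comes from a choice operator. The pair
  \<open>(0, B)\<close> shows that the choice succeeds, and the value is independent of the base
  point and frame chosen.\<close>

lemma vol_eq_frame_integral:
  assumes B: "orthonormal B" and hull: "affine hull M = span B" and [measurable]: "M \<in> sets borel"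
  shows "vol M = enn2real (frame_integral B (indicator M))"
proof -
  define P where "P = (\<lambda>(p, B). orthonormal_frame (affine hull M) p B)"
  obtain p B' where pB: "Eps P = (p, B')" by fastforce
  have "P (0, B)"
    using B by (simp add: P_def orthonormal_frame_def orthonormal_def hull)
  then have "P (Eps P)" by (rule someI)
  then have "orthonormal_frame (span B) p B'" unfolding pB by (simp add: P_def hull)
  then have B': "orthonormal B'" and sp: "span B = (+) p ` span B'"
    by (simp_all add: orthonormal_frame_def orthonormal_def)
  \<comment> \<open>The hull contains the origin, so \<open>p\<close> lies in \<open>span B'\<close>
    and both frames span the same subspace.\<close>
  have "0 \<in> (+) p ` span B'" using sp[symmetric] by (simp add: span_zero)
  then have p: "p \<in> span B'"
    by (metis (no_types, lifting) add_eq_0_iff imageE minus_minus span_neg)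
  have span: "span B = span B'"
  proof
    show "span B \<subseteq> span B'" unfolding sp using p by (auto intro: span_add)
    show "span B' \<subseteq> span B" unfolding sp
    proof
      fix x assume "x \<in> span B'"
      then have "x - p \<in> span B'" using p by (rule span_diff)
      then show "x \<in> (+) p ` span B'" by (intro image_eqI[of _ _ "x - p"]) auto
    qed
  qed
  have fin: "finite B'" using B' by (rule orthonormal_finite)
  have "emeasure (flat_measure p B') M = (\<integral>\<^sup>+x. indicator M x \<partial>flat_measure p B')"
    by (rule nn_integral_indicator[symmetric]) (simp add: flat_measure_def)
  also have "\<dots> = frame_integral B' (\<lambda>x. indicator M (x + p))"
    unfolding flat_measure_def frame_integral_def
    by (subst nn_integral_distr) (auto simp: add.commute)
  also have "\<dots> = frame_integral B' (indicator M)"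
    using fin p by (intro frame_integral_translate) auto
  also have "\<dots> = frame_integral B (indicator M)"
    using B B' span by (intro frame_integral_frame_irrelevant) auto
  finally show ?thesis
    by (simp add: vol_def measure_def pB flip: P_def)
qed

text \<open>The layer-cake formula: \<open>exp (- N x)\<close> is the integral of
  \<open>exp (- r)\<close> over \<open>r \<ge> N x\<close>. By homogeneity the sublevel set at
  \<open>r\<close> has \<open>r ^ card B\<close> times the measure of the one at \<open>1\<close>,
  and the Gamma integral yields the factorial.\<close>

lemma frame_integral_exp_gauge:
  fixes N :: "'a::euclidean_space \<Rightarrow> real"
  assumes "finite B" and [measurable]: "N \<in> borel_measurable borel"
    and N_nonneg: "\<And>x. 0 \<le> N x" and N_scale: "\<And>x r. 0 < r \<Longrightarrow> N (r *\<^sub>R x) = r * N x"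
  shows "frame_integral B (\<lambda>x. ennreal (exp (- N x))) =
         ennreal (fact (card B)) * frame_integral B (indicator {x. N x \<le> 1})"
proof -
  define V where "V = frame_integral B (indicator {x. N x \<le> 1})"
  have tail: "ennreal (exp (- a)) = (\<integral>\<^sup>+r. ennreal (exp (- r)) * (if a \<le> r then 1 else 0) \<partial>lborel)" for a :: real
  proof -
    have "((\<lambda>x::real. - exp (- x)) \<longlongrightarrow> 0) at_top"
      using tendsto_minus[OF filterlim_compose[OF exp_at_bot filterlim_uminus_at_bot_at_top]] by simp
    then have "(\<integral>\<^sup>+r. ennreal (exp (- r)) * indicator {a..} r \<partial>lborel) = ennreal (0 - (- exp (- a)))"
      by (intro nn_integral_FTC_atLeast) (auto intro!: derivative_eq_intros)
    then show ?thesis by (simp add: indicator_def of_bool_def)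
  qed
  have level: "frame_integral B (\<lambda>x. (if N x \<le> r then 1 else 0)) = ennreal (r ^ card B) * V" if "0 < r" for r
  proof -
    have "frame_integral B (\<lambda>x. (if N x \<le> r then 1 else 0)) =
        ennreal (r ^ card B) * frame_integral B (\<lambda>x. (if N (r *\<^sub>R x) \<le> r then 1 else 0))"
      using assms(1) that by (intro frame_integral_scale[where f="\<lambda>x. (if N x \<le> r then 1 else 0)"]) auto
    also have "(\<lambda>x. if N (r *\<^sub>R x) \<le> r then 1 else 0 :: ennreal) = indicator {x. N x \<le> 1}"
      using that by (auto simp: N_scale indicator_def fun_eq_iff)
    finally show ?thesis by (simp add: V_def)
  qed
  have "frame_integral B (\<lambda>x. ennreal (exp (- N x))) =
      (\<integral>\<^sup>+r. frame_integral B (\<lambda>x. ennreal (exp (- r)) * (if N x \<le> r then 1 else 0)) \<partial>lborel)"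
    by (subst tail, rule frame_integral_swap) (use assms(1) sigma_finite_lborel in auto)
  also have "\<dots> = (\<integral>\<^sup>+r. (ennreal (r ^ card B * exp (- r)) * indicator {0..} r) * V \<partial>lborel)"
  proof (rule nn_integral_cong_AE)
    show "AE r in lborel. frame_integral B (\<lambda>x. ennreal (exp (- r)) * (if N x \<le> r then 1 else 0)) =
        (ennreal (r ^ card B * exp (- r)) * indicator {0..} r) * V"
      \<comment> \<open>The level \<open>r = 0\<close> is discarded as a null set; for negative
        \<open>r\<close> the sublevel sets are empty.\<close>
      using AE_lborel_singleton[of "0::real"]
    proof eventually_elim
      case (elim r)
      have *: "frame_integral B (\<lambda>x. ennreal (exp (- r)) * (if N x \<le> r then 1 else 0)) =
          ennreal (exp (- r)) * frame_integral B (\<lambda>x. (if N x \<le> r then 1 else 0))"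
        by (rule frame_integral_cmult) measurable
      show ?case
      proof (cases "0 < r")
        case True
        then show ?thesis unfolding * level[OF True]
          by (simp add: ennreal_mult mult_ac)
      next
        case False
        then have "(if N x \<le> r then 1 else 0 :: ennreal) = 0" for x
          using elim N_nonneg[of x] by (auto simp: indicator_def)
        then show ?thesis unfolding * using False elim
          by (simp add: frame_integral_def)
      qed
    qed
  qed
  also have "\<dots> = ennreal (fact (card B)) * V"
    by (subst nn_integral_multc) (auto simp: nn_intergal_power_times_exp_Ici)
  finally show ?thesis by (simp add: V_def)
qed

section \<open>Marginals of the exponential of a gauge\<close>

text \<open>A sublinear function comparable with the norm. Homogeneity is restricted to nonnegative
  factors because the convex body behind it may be asymmetric.\<close>

locale gauge =
  fixes N :: "'a::euclidean_space \<Rightarrow> real" and c L :: real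
  assumes N_add: "N (x + y) \<le> N x + N y"
    and N_scale: "0 \<le> r \<Longrightarrow> N (r *\<^sub>R x) = r * N x"
    and N_lower: "c * norm x \<le> N x"
    and N_upper: "N x \<le> L * norm x"
    and c_pos: "0 < c"
begin

lemma N_nonneg: "0 \<le> N x"
  using N_lower[of x] c_pos by (meson mult_nonneg_nonneg norm_ge_zero less_imp_le order_trans)

lemma N_zero [simp]: "N 0 = 0"
  using N_scale[of 0 0] by simp

lemma N_eq_0D: "N x = 0 \<Longrightarrow> x = 0"
  using N_lower[of x] c_pos by (metis mult_pos_pos not_le zero_less_norm_iff)

lemma N_sum: "N (sum f F) \<le> (\<Sum>i\<in>F. N (f i))"
  by (induction F rule: infinite_finite_induct) (auto intro: order_trans[OF N_add])

lemma L_nonneg: "0 \<le> L"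
proof -
  obtain b :: 'a where "b \<in> Basis" using nonempty_Basis by blast
  then show ?thesis using N_upper[of b] N_nonneg[of b] by simp
qed

lemma N_diff: "N (x + h) \<le> N x + L * norm h"
  using N_add[of x h] N_upper[of h] by linarith

lemma N_continuous: "continuous_on S N"
proof -
  have "\<bar>N x - N y\<bar> \<le> L * norm (x - y)" for x y
    using N_diff[of x "y - x"] N_diff[of y "x - y"] by (simp add: norm_minus_commute)
  then have "L-lipschitz_on S N"
    using L_nonneg by (intro lipschitz_onI) (auto simp: dist_norm dist_real_def)
  then show ?thesis by (rule lipschitz_on_continuous_on)
qed

lemma N_measurable [measurable]: "N \<in> borel_measurable borel"
  by (rule borel_measurable_continuous_onI[OF N_continuous])

text \<open>The integral of \<open>exp (- N)\<close> over the flat through \<open>v\<close> with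
  directions \<open>B\<close>. As \<open>enn2real\<close> sends infinity to zero, finiteness has to
  be established first.\<close>

definition marginal :: "'a set \<Rightarrow> 'a \<Rightarrow> real" where
  "marginal B v = enn2real (frame_integral B (\<lambda>x. ennreal (exp (- N (v + x)))))"

text \<open>The lower bound on \<open>N\<close> reduces the claim to
  \<open>exp (- (c * norm x))\<close>. The integral of this function is a factorial times the volume
  of a ball, and the indicator of the ball is dominated by a multiple of a Gaussian.\<close>

lemma frame_integral_finite:
  assumes "orthonormal B"
  shows "frame_integral B (\<lambda>x. ennreal (exp (- N (v + x)))) < \<infinity>"
proof -
  have fin: "finite B" using assms by (rule orthonormal_finite)
  have "frame_integral B (indicator {x. c * norm x \<le> 1}) \<le>
      frame_integral B (\<lambda>x. ennreal (exp ((1 / c)\<^sup>2)) * ennreal (exp (- (norm x)\<^sup>2)))"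
  proof (rule frame_integral_mono)
    fix x
    have "(norm x)\<^sup>2 \<le> (1 / c)\<^sup>2" if "c * norm x \<le> 1"
      using that c_pos by (intro power_mono) (auto simp: field_simps)
    then show "indicator {x. c * norm x \<le> 1} x \<le> ennreal (exp ((1 / c)\<^sup>2)) * ennreal (exp (- (norm x)\<^sup>2))"
      by (auto simp: indicator_def ennreal_mult[symmetric] mult_exp_exp)
  qed
  also have "\<dots> < \<infinity>"
    using frame_integral_gaussian_bounds[OF assms] by (subst frame_integral_cmult) (auto simp: ennreal_mult_less_top)
  finally have "frame_integral B (\<lambda>x. ennreal (exp (- (c * norm x)))) < \<infinity>"
    using c_pos fin by (subst frame_integral_exp_gauge) (auto simp: ennreal_mult_less_top)
  then have "ennreal (exp (c * norm v)) * frame_integral B (\<lambda>x. ennreal (exp (- (c * norm x)))) < \<infinity>"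
    by (simp add: ennreal_mult_less_top)
  moreover have "frame_integral B (\<lambda>x. ennreal (exp (- N (v + x)))) \<le>
      frame_integral B (\<lambda>x. ennreal (exp (c * norm v)) * ennreal (exp (- (c * norm x))))"
  proof (rule frame_integral_mono)
    fix x
    have "norm x \<le> norm (v + x) + norm v"
      using norm_triangle_ineq4[of "v + x" v] by simp
    then have "c * norm x \<le> c * (norm (v + x) + norm v)"
      using c_pos by (intro mult_left_mono) auto
    then have "- N (v + x) \<le> c * norm v + - (c * norm x)"
      using N_lower[of "v + x"] by (simp add: algebra_simps)
    then show "ennreal (exp (- N (v + x))) \<le> ennreal (exp (c * norm v)) * ennreal (exp (- (c * norm x)))"
      by (simp add: ennreal_mult[symmetric] mult_exp_exp)
  qed
  ultimately show ?thesis
    by (subst (asm) frame_integral_cmult) auto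
qed

lemma marginal_ennreal:
  "orthonormal B \<Longrightarrow>
    ennreal (marginal B v) = frame_integral B (\<lambda>x. ennreal (exp (- N (v + x))))"
  unfolding marginal_def using frame_integral_finite by (intro ennreal_enn2real) auto

text \<open>Since \<open>L * t \<le> t\<^sup>2 + L\<^sup>2\<close>, the integrand is at least a
  positive multiple of a Gaussian.\<close>

lemma marginal_pos:
  assumes "orthonormal B"
  shows "0 < marginal B v"
proof -
  have "0 < ennreal (exp (- N v - L\<^sup>2)) * frame_integral B (\<lambda>x. ennreal (exp (- (norm x)\<^sup>2)))"
    using frame_integral_gaussian_bounds[OF assms] by (simp add: ennreal_zero_less_mult_iff)
  also have "\<dots> = frame_integral B (\<lambda>x. ennreal (exp (- N v - L\<^sup>2)) * ennreal (exp (- (norm x)\<^sup>2)))"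
    by (rule frame_integral_cmult[symmetric]) measurable
  also have "\<dots> \<le> frame_integral B (\<lambda>x. ennreal (exp (- N (v + x))))"
  proof (rule frame_integral_mono)
    fix x :: 'a
    have "0 \<le> (L - norm x)\<^sup>2 + L * norm x"
      using L_nonneg by (intro add_nonneg_nonneg) auto
    then have "L * norm x \<le> (norm x)\<^sup>2 + L\<^sup>2"
      by (simp add: power2_diff)
    then have "- N v - L\<^sup>2 + - (norm x)\<^sup>2 \<le> - N (v + x)"
      using N_diff[of v x] by linarith
    then show "ennreal (exp (- N v - L\<^sup>2)) * ennreal (exp (- (norm x)\<^sup>2)) \<le> ennreal (exp (- N (v + x)))"
      by (simp add: ennreal_mult[symmetric] mult_exp_exp)
  qed
  finally show ?thesis
    by (simp add: marginal_ennreal[OF assms, symmetric])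
qed

lemma marginal_empty [simp]: "marginal {} v = exp (- N v)"
  by (simp add: marginal_def)

lemma marginal_shift_le:
  assumes "orthonormal B"
  shows "marginal B (v + h) \<le> exp (L * norm h) * marginal B v"
proof -
  have "ennreal (marginal B (v + h)) \<le>
      frame_integral B (\<lambda>x. ennreal (exp (L * norm h)) * ennreal (exp (- N (v + x))))"
    unfolding marginal_ennreal[OF assms]
  proof (rule frame_integral_mono)
    fix x
    have "N (v + x) \<le> N (v + h + x) + L * norm h"
      using N_diff[of "v + h + x" "- h"] by (simp add: algebra_simps)
    then show "ennreal (exp (- N (v + h + x))) \<le> ennreal (exp (L * norm h)) * ennreal (exp (- N (v + x)))"
      by (simp add: ennreal_mult[symmetric] mult_exp_exp)
  qed
  also have "\<dots> = ennreal (exp (L * norm h)) * ennreal (marginal B v)"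
    unfolding marginal_ennreal[OF assms] by (rule frame_integral_cmult) measurable
  finally show ?thesis
    using marginal_pos[OF assms, of v] by (simp add: ennreal_mult[symmetric] ennreal_le_iff)
qed

text \<open>A shift by \<open>h\<close> changes the integrand by a factor of at most
  \<open>exp (L * norm h)\<close>, so the logarithm of a marginal inherits the Lipschitz constant
  \<open>L\<close> of \<open>N\<close>.\<close>

lemma marginal_continuous:
  assumes "orthonormal B"
  shows "continuous_on S (marginal B)"
proof -
  have ln_le: "ln (marginal B (v + h)) \<le> ln (marginal B v) + L * norm h" for v h
  proof -
    have "ln (marginal B (v + h)) \<le> ln (exp (L * norm h) * marginal B v)"
      using marginal_shift_le[OF assms] marginal_pos[OF assms] by (subst ln_le_cancel_iff) auto
    then show ?thesis using marginal_pos[OF assms, of v] by (simp add: ln_mult)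
  qed
  have "\<bar>ln (marginal B x) - ln (marginal B y)\<bar> \<le> L * norm (x - y)" for x y
    using ln_le[of x "y - x"] ln_le[of y "x - y"] by (simp add: norm_minus_commute)
  then have "L-lipschitz_on S (\<lambda>x. ln (marginal B x))"
    using L_nonneg by (intro lipschitz_onI) (auto simp: dist_norm dist_real_def)
  then have "continuous_on S (\<lambda>x. exp (ln (marginal B x)))"
    by (intro continuous_intros lipschitz_on_continuous_on)
  then show ?thesis using marginal_pos[OF assms] by simp
qed

lemma
  assumes "orthonormal (insert b B)" "b \<notin> B"
  shows marginal_insert: "marginal (insert b B) v = (\<integral>t. marginal B (v + t *\<^sub>R b) \<partial>lborel)"
    and integrable_marginal_line: "integrable lborel (\<lambda>t. marginal B (v + t *\<^sub>R b))"
proof -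
  have B: "orthonormal B" using assms(1) by (auto simp: orthonormal_def pairwise_insert)
  have cont: "continuous_on UNIV (\<lambda>t. marginal B (v + t *\<^sub>R b))"
    by (intro continuous_on_compose2[OF marginal_continuous[OF B, of UNIV]] continuous_intros) auto
  have [measurable]: "(\<lambda>t. marginal B (v + t *\<^sub>R b)) \<in> borel_measurable borel"
    by (rule borel_measurable_continuous_onI[OF cont])
  have eq: "ennreal (marginal (insert b B) v) = (\<integral>\<^sup>+t. ennreal (marginal B (v + t *\<^sub>R b)) \<partial>lborel)"
    unfolding marginal_ennreal[OF B] marginal_ennreal[OF assms(1)]
    using orthonormal_finite[OF B] assms(2) by (subst frame_integral_insert) (auto simp: algebra_simps)
  have nonneg: "0 \<le> marginal B w" for w using marginal_pos[OF B, of w] by simp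
  show "integrable lborel (\<lambda>t. marginal B (v + t *\<^sub>R b))"
    by (rule integrableI_nonneg) (use nonneg in \<open>auto simp flip: eq\<close>)
  show "marginal (insert b B) v = (\<integral>t. marginal B (v + t *\<^sub>R b) \<partial>lborel)"
    using nonneg marginal_pos[OF assms(1), of v]
    by (subst integral_eq_nn_integral) (auto simp flip: eq)
qed

lemma marginal_origin:
  assumes "orthonormal B"
  shows "marginal B 0 = fact (card B) * enn2real (frame_integral B (indicator {x. N x \<le> 1}))"
  unfolding marginal_def using orthonormal_finite[OF assms]
  by (simp add: frame_integral_exp_gauge N_nonneg N_scale enn2real_mult)

end

section \<open>Uniform covers and tight tuples\<close>

text \<open>\<open>E\<close> stands for the coordinate frame and \<open>A i\<close> for the basis
  vectors spanning the \<open>i\<close>-th subspace; the indexing by \<open>I\<close> permits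
  repeated members of the cover.\<close>

locale gauge_cover = gauge N c L for N :: "'a::euclidean_space \<Rightarrow> real" and c L +
  fixes E :: "'a set" and I :: "'i set" and A :: "'i \<Rightarrow> 'a set" and s :: nat
  assumes E: "orthonormal E" "span E = UNIV"
    and I: "finite I"
    and s_pos: "0 < s"
    and cover: "\<And>b. b \<in> E \<Longrightarrow> card {i \<in> I. b \<in> A i} = s"
begin

text \<open>Equality in the inequality between marginals over \<open>R\<close> at the base points
  \<open>v\<close>. For \<open>R = E\<close> and zero base points this is the equality under study;
  for empty \<open>R\<close> it says that \<open>N\<close> is additive on the tuple.\<close>

definition tight :: "'a set \<Rightarrow> ('i \<Rightarrow> 'a) \<Rightarrow> bool" where
  "tight R v \<longleftrightarrow> (\<Prod>i\<in>I. marginal (R \<inter> A i) (v i)) = marginal R ((\<Sum>i\<in>I. v i) /\<^sub>R s) ^ s"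

text \<open>Adding \<open>b\<close> to \<open>R\<close> changes only the \<open>s\<close> marginals
  with \<open>b \<in> A i\<close>; the others form the constant factor \<open>C\<close>. Along lines
  in direction \<open>b\<close> this is the one-dimensional Prekopa-Leindler inequality for
  \<open>s\<close> functions, and its equality case produces the new tight tuple.\<close>

lemma
  assumes b: "b \<in> E" "b \<notin> R" and R: "R \<subseteq> E"
    and le: "\<And>v. (\<Prod>i\<in>I. marginal (R \<inter> A i) (v i)) \<le> marginal R ((\<Sum>i\<in>I. v i) /\<^sub>R s) ^ s"
  shows marginal_inequality_insert:
      "(\<Prod>i\<in>I. marginal (insert b R \<inter> A i) (v i)) \<le> marginal (insert b R) ((\<Sum>i\<in>I. v i) /\<^sub>R s) ^ s"
    and tight_insert:
      "\<lbrakk>tight (insert b R) v; S \<subseteq> {i \<in> I. b \<in> A i}; S \<noteq> {}\<rbrakk> \<Longrightarrow>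
        \<exists>t. (\<Sum>i\<in>S. t i) = a \<and> tight R (\<lambda>i. v i + (if b \<in> A i then t i else 0) *\<^sub>R b)"
proof -
  define J where "J = {i \<in> I. b \<in> A i}"
  define g where "g i t = marginal (R \<inter> A i) (v i + t *\<^sub>R b)" for i t
  define G where "G t = marginal R ((\<Sum>i\<in>I. v i) /\<^sub>R s + t *\<^sub>R b)" for t
  define C where "C = (\<Prod>i\<in>I - J. marginal (R \<inter> A i) (v i))"
  have "card J = s" using cover[OF b(1)] by (simp add: J_def)
  then have "J \<noteq> {}" using s_pos by auto
  then have J: "finite J" "J \<noteq> {}" "card J = s" "J \<subseteq> I"
    using \<open>card J = s\<close> I by (auto simp: J_def)
  have on: "orthonormal (R \<inter> A i)" "orthonormal R" "orthonormal (insert b R)"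
    "orthonormal (insert b (R \<inter> A i))" for i
    using R b by (auto intro!: orthonormal_mono[OF E(1)])
  have J_sum: "(\<Sum>i\<in>I. (if b \<in> A i then t i else 0)) = (\<Sum>i\<in>J. t i)" for t :: "'i \<Rightarrow> real"
    unfolding J_def using I by (rule sum.inter_filter[symmetric])
  have split: "(\<Prod>i\<in>I. f i) = (\<Prod>i\<in>I - J. f i) * (\<Prod>i\<in>J. f i)" for f :: "'i \<Rightarrow> real"
    by (rule prod.subset_diff[OF J(4) I])
  have lhs: "(\<Prod>i\<in>I. marginal (R \<inter> A i) (v i + (if b \<in> A i then t i else 0) *\<^sub>R b)) =
      C * (\<Prod>i\<in>J. g i (t i))" for t
    unfolding split C_def g_def by (intro arg_cong2[where f="(*)"] prod.cong) (auto simp: J_def)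
  \<comment> \<open>Only the entries indexed by \<open>J\<close> move and \<open>card J = s\<close>,
    so division of the sum by \<open>s\<close> shifts the point by the mean of \<open>t\<close> over
    \<open>J\<close>.\<close>
  have rhs: "marginal R ((\<Sum>i\<in>I. v i + (if b \<in> A i then t i else 0) *\<^sub>R b) /\<^sub>R s) =
      G ((\<Sum>i\<in>J. t i) / card J)" for t
    unfolding G_def sum.distrib scaleR_left.sum[symmetric] J_sum J(3)
    by (simp add: scaleR_add_right divide_inverse mult.commute)
  have whole: "(\<Prod>i\<in>I. marginal (insert b R \<inter> A i) (v i)) = C * (\<Prod>i\<in>J. \<integral>t. g i t \<partial>lborel)"
  proof -
    have "marginal (insert b R \<inter> A i) (v i) = (\<integral>t. g i t \<partial>lborel)" if "i \<in> J" for i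
      using that b on(4)[of i] unfolding g_def by (subst marginal_insert[symmetric]) (auto simp: J_def)
    moreover have "insert b R \<inter> A i = R \<inter> A i" if "i \<in> I - J" for i
      using that by (auto simp: J_def)
    ultimately show ?thesis
      unfolding split C_def by (intro arg_cong2[where f="(*)"] prod.cong) auto
  qed
  have Whole: "marginal (insert b R) ((\<Sum>i\<in>I. v i) /\<^sub>R s) = (\<integral>t. G t \<partial>lborel)"
    unfolding G_def using on b by (subst marginal_insert[symmetric]) auto
  have line_cont: "continuous_on UNIV (\<lambda>t. marginal Q (w + t *\<^sub>R b))" if "orthonormal Q" for Q w
    by (intro continuous_on_compose2[OF marginal_continuous[OF that, of UNIV]] continuous_intros) auto
  have g_cont: "continuous_on UNIV (g i)" for i
    unfolding g_def by (rule line_cont[OF on(1)])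
  have G_cont: "continuous_on UNIV G"
    unfolding G_def by (rule line_cont[OF on(2)])
  have g_pos: "0 < g i t" for i t by (simp add: g_def marginal_pos on)
  have G_pos: "0 < G t" for t by (simp add: G_def marginal_pos on)
  have C_pos: "0 < C" unfolding C_def using on by (intro prod_pos marginal_pos)
  have g_int: "integrable lborel (g i)" for i
    unfolding g_def using b on by (intro integrable_marginal_line) auto
  have G_int: "integrable lborel G"
    unfolding G_def using b on by (intro integrable_marginal_line) auto
  have le': "C * (\<Prod>i\<in>J. g i (t i)) \<le> G ((\<Sum>i\<in>J. t i) / card J) ^ card J" for t
    using le[of "\<lambda>i. v i + (if b \<in> A i then t i else 0) *\<^sub>R b"] unfolding lhs rhs by (simp add: J(3))
  note PL = Prekopa_Leindler_real[where I=J and g=g and G=G and C=C,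
      OF J(1,2) g_cont g_pos g_int G_cont G_pos G_int C_pos le']
  note PL_eq = Prekopa_Leindler_real_equality[where I=J and g=g and G=G and C=C,
      OF J(1,2) g_cont g_pos g_int G_cont G_pos G_int C_pos le']
  show "(\<Prod>i\<in>I. marginal (insert b R \<inter> A i) (v i)) \<le> marginal (insert b R) ((\<Sum>i\<in>I. v i) /\<^sub>R s) ^ s"
    unfolding whole Whole using PL by (simp add: J(3))
  assume "tight (insert b R) v" and S: "S \<subseteq> {i \<in> I. b \<in> A i}" "S \<noteq> {}"
  then have "C * (\<Prod>i\<in>J. \<integral>t. g i t \<partial>lborel) = (\<integral>t. G t \<partial>lborel) ^ card J"
    by (simp add: tight_def whole Whole J(3))
  then obtain t where t: "(\<Sum>i\<in>S. t i) = a"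
      "C * (\<Prod>i\<in>J. g i (t i)) = G ((\<Sum>i\<in>J. t i) / card J) ^ card J"
    using PL_eq[of S a] S by (auto simp: J_def)
  then show "\<exists>t. (\<Sum>i\<in>S. t i) = a \<and> tight R (\<lambda>i. v i + (if b \<in> A i then t i else 0) *\<^sub>R b)"
    by (intro exI[of _ t]) (simp add: tight_def lhs rhs J(3))
qed

text \<open>With no directions the claim is the sublinearity of \<open>N\<close>; directions are
  then integrated one at a time. All directions with zero base points give the inequality of
  Liakopoulos.\<close>

lemma marginal_inequality:
  assumes "R \<subseteq> E"
  shows "(\<Prod>i\<in>I. marginal (R \<inter> A i) (v i)) \<le> marginal R ((\<Sum>i\<in>I. v i) /\<^sub>R s) ^ s"
proof -
  have "finite R" using assms E(1) orthonormal_finite finite_subset by blast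
  then show ?thesis using assms
  proof (induction R arbitrary: v rule: finite_induct)
    case empty
    have "real s * N ((\<Sum>i\<in>I. v i) /\<^sub>R s) = N (\<Sum>i\<in>I. v i)"
      using s_pos by (simp add: N_scale)
    then have "- (\<Sum>i\<in>I. N (v i)) \<le> real s * (- N ((\<Sum>i\<in>I. v i) /\<^sub>R s))"
      using N_sum[of v I] by simp
    then show ?case
      using I by (simp add: exp_sum[symmetric] sum_negf flip: exp_of_nat_mult)
  next
    case (insert b R)
    then show ?case by (intro marginal_inequality_insert) auto
  qed
qed

text \<open>Descends through the directions in \<open>R\<close>. Each \<open>b\<close> leaves one
  free value, spent here on the sum of its coefficients over a chosen nonempty set
  \<open>S b\<close> of indices.\<close>

lemma tight_chain:
  assumes "finite R" "R \<inter> Q = {}" "R \<union> Q \<subseteq> E"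
    and S: "\<And>b. b \<in> R \<Longrightarrow> S b \<subseteq> {i \<in> I. b \<in> A i}" "\<And>b. b \<in> R \<Longrightarrow> S b \<noteq> {}"
    and "tight (R \<union> Q) v"
  shows "\<exists>t. (\<forall>b\<in>R. (\<Sum>i\<in>S b. t i b) = a b) \<and> tight Q (\<lambda>i. v i + (\<Sum>b\<in>R \<inter> A i. t i b *\<^sub>R b))"
  using assms
proof (induction R arbitrary: v rule: finite_induct)
  case (insert b R)
  have "\<exists>t. (\<Sum>i\<in>S b. t i) = a b \<and> tight (R \<union> Q) (\<lambda>i. v i + (if b \<in> A i then t i else 0) *\<^sub>R b)"
    using insert.prems insert.hyps
    by (intro tight_insert marginal_inequality) auto
  then obtain t0 where t0: "(\<Sum>i\<in>S b. t0 i) = a b"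
    "tight (R \<union> Q) (\<lambda>i. v i + (if b \<in> A i then t0 i else 0) *\<^sub>R b)" by blast
  have "\<exists>t. (\<forall>b\<in>R. (\<Sum>i\<in>S b. t i b) = a b) \<and>
      tight Q (\<lambda>i. v i + (if b \<in> A i then t0 i else 0) *\<^sub>R b + (\<Sum>b\<in>R \<inter> A i. t i b *\<^sub>R b))"
    using insert.prems by (intro insert.IH t0(2)) auto
  then obtain t where t: "\<forall>b\<in>R. (\<Sum>i\<in>S b. t i b) = a b"
      "tight Q (\<lambda>i. v i + (if b \<in> A i then t0 i else 0) *\<^sub>R b + (\<Sum>b\<in>R \<inter> A i. t i b *\<^sub>R b))" by blast
  define t' where "t' i = (t i)(b := t0 i)" for i
  have "(\<Sum>x\<in>insert b R \<inter> A i. t' i x *\<^sub>R x) =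
      (if b \<in> A i then t0 i else 0) *\<^sub>R b + (\<Sum>x\<in>R \<inter> A i. t i x *\<^sub>R x)" for i
  proof -
    have "(\<Sum>x\<in>R \<inter> A i. t' i x *\<^sub>R x) = (\<Sum>x\<in>R \<inter> A i. t i x *\<^sub>R x)"
      using insert.hyps(2) by (intro sum.cong) (auto simp: t'_def)
    then show ?thesis
      using insert.hyps by (simp add: Int_insert_left t'_def)
  qed
  then have "tight Q (\<lambda>i. v i + (\<Sum>x\<in>insert b R \<inter> A i. t' i x *\<^sub>R x))"
    using t(2) by (simp add: add.assoc)
  moreover have "(\<Sum>i\<in>S x. t' i x) = a x" if "x \<in> insert b R" for x
    using that t(1) t0(1) insert.hyps(2) by (cases "x = b") (auto simp: t'_def)
  ultimately show ?case by (intro exI[of _ t']) simp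
qed simp

lemma tight_empty_iff: "tight {} v \<longleftrightarrow> N (\<Sum>i\<in>I. v i) = (\<Sum>i\<in>I. N (v i))"
proof -
  have "real s * N ((\<Sum>i\<in>I. v i) /\<^sub>R s) = N (\<Sum>i\<in>I. v i)"
    using s_pos by (simp add: N_scale)
  then show ?thesis
    using I by (auto simp: tight_def exp_sum[symmetric] sum_negf simp flip: exp_of_nat_mult)
qed

text \<open>Descending from a tight tuple, the entries not meeting \<open>T\<close> can be made to sum to \<open>z\<close>;
  afterwards one entry meeting \<open>T\<close> is sent to infinity in the direction \<open>y\<close>. On the resulting
  tuples the gauge is additive, and by homogeneity the limit only sees \<open>z\<close> and \<open>y\<close>.\<close>

lemma tight_imp_additive:
  assumes tight: "tight E (\<lambda>_. 0)" and T: "T \<subseteq> E"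
    and block: "\<And>i. i \<in> I \<Longrightarrow> T \<subseteq> A i \<or> T \<inter> A i = {}"
    and i0: "i0 \<in> I" "T \<subseteq> A i0" "T \<noteq> {}"
    and separated: "\<And>b. b \<in> E - T \<Longrightarrow> \<exists>i\<in>I. b \<in> A i \<and> T \<inter> A i = {}"
    and z: "z \<in> span (E - T)" and y: "y \<in> span T"
  shows "N (z + y) = N z + N y"
proof -
  have finE: "finite E" using E(1) by (rule orthonormal_finite)
  then have fin: "finite T" "finite (E - T)" using T finite_subset by auto
  obtain za where za: "z = (\<Sum>b\<in>E - T. za b *\<^sub>R b)" using z fin by (auto simp: span_finite)
  obtain ya where ya: "y = (\<Sum>b\<in>T. ya b *\<^sub>R b)" using y fin by (auto simp: span_finite)
  \<comment> \<open>The entries indexed by \<open>D\<close> no longer change once only the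
    directions in \<open>T\<close> remain.\<close>
  define D where "D = {i \<in> I. T \<inter> A i = {}}"
  have D: "finite D" "D \<subseteq> I" "i0 \<notin> D" using I i0 by (auto simp: D_def)
  \<comment> \<open>The descent from \<open>E\<close> to \<open>T\<close> prescribes the coefficient
    sums over \<open>D\<close> so that the entries there add up to \<open>z\<close>;
    \<open>separated\<close> makes the index sets nonempty.\<close>
  have "\<exists>t. (\<forall>b\<in>E - T. (\<Sum>i\<in>{i \<in> D. b \<in> A i}. t i b) = za b) \<and>
      tight T (\<lambda>i. 0 + (\<Sum>b\<in>(E - T) \<inter> A i. t i b *\<^sub>R b))"
  proof (rule tight_chain)
    show "{i \<in> D. b \<in> A i} \<noteq> {}" if "b \<in> E - T" for b
      using separated[OF that] by (auto simp: D_def)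
    have "E - T \<union> T = E" using T by auto
    then show "tight (E - T \<union> T) (\<lambda>_. 0)" using tight by simp
  qed (use fin T in \<open>auto simp: D_def\<close>)
  then obtain t where t: "\<And>b. b \<in> E - T \<Longrightarrow> (\<Sum>i\<in>{i \<in> D. b \<in> A i}. t i b) = za b"
      "tight T (\<lambda>i. 0 + (\<Sum>b\<in>(E - T) \<inter> A i. t i b *\<^sub>R b))" by blast
  define v where "v i = (\<Sum>b\<in>(E - T) \<inter> A i. t i b *\<^sub>R b)" for i
  have sum_v: "(\<Sum>i\<in>D. v i) = z"
  proof -
    have "(\<Sum>i\<in>D. v i) = (\<Sum>b\<in>E - T. \<Sum>i\<in>{i \<in> D. b \<in> A i}. t i b *\<^sub>R b)"
      unfolding v_def Int_def mem_Collect_eq using D(1) fin(2)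
      by (subst sum.swap_restrict) auto
    then show ?thesis
      unfolding za by (simp add: t(1) flip: scaleR_left.sum)
  qed
  have N_z: "N z \<le> (\<Sum>i\<in>D. N (v i))" unfolding sum_v[symmetric] by (rule N_sum)
  \<comment> \<open>\<open>v\<close> is fixed before \<open>r\<close>. The descent from
    \<open>T\<close> to no direction can turn entry \<open>i0\<close> into
    \<open>v i0 + r *\<^sub>R y\<close>; after division by \<open>r\<close> it differs from
    \<open>y\<close> by a term that vanishes as \<open>r\<close> grows.\<close>
  have ray: "N z + N (v i0 /\<^sub>R r + y) \<le> N (z + (v i0 /\<^sub>R r + y))" if r: "1 \<le> r" for r
  proof -
    have "\<exists>t. (\<forall>b\<in>T. (\<Sum>i\<in>{i0}. t i b) = r * ya b) \<and>
        tight {} (\<lambda>i. v i + (\<Sum>b\<in>T \<inter> A i. t i b *\<^sub>R b))"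
      using fin T i0 t(2) by (intro tight_chain) (auto simp: v_def)
    then obtain t' where t': "\<And>b. b \<in> T \<Longrightarrow> t' i0 b = r * ya b"
        "tight {} (\<lambda>i. v i + (\<Sum>b\<in>T \<inter> A i. t' i b *\<^sub>R b))" by auto
    define w where "w i = v i + (\<Sum>b\<in>T \<inter> A i. t' i b *\<^sub>R b)" for i
    have w: "N (\<Sum>i\<in>I. w i) = (\<Sum>i\<in>I. N (w i))"
      using t'(2) by (simp add: tight_empty_iff w_def)
    have wD: "w i = v i" if "i \<in> D" for i using that by (simp add: w_def D_def)
    have wi0: "w i0 = v i0 + r *\<^sub>R y"
      using i0(2) by (simp add: w_def ya t'(1) scaleR_sum_right Int_absorb2 cong: sum.cong)
    have split: "sum f I = sum f (I - insert i0 D) + (f i0 + sum f D)" for f :: "'i \<Rightarrow> 'b::comm_monoid_add"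
      using D i0(1) I sum.subset_diff[of "insert i0 D" I f] by simp
    \<comment> \<open>The contributions of the remaining entries cancel, so additivity on the whole
      tuple leaves superadditivity for \<open>z\<close> and \<open>w i0\<close>.\<close>
    have "N (\<Sum>i\<in>I. w i) \<le> (\<Sum>i\<in>I - insert i0 D. N (w i)) + N (w i0 + z)"
      unfolding split[of w] using N_add N_sum[of w "I - insert i0 D"]
      by (smt (verit, best) sum.cong sum_v wD)
    moreover have "(\<Sum>i\<in>D. N (w i)) = (\<Sum>i\<in>D. N (v i))" using wD by simp
    ultimately have sup: "N z + N (w i0) \<le> N (z + w i0)"
      using w N_z unfolding split[of "\<lambda>i. N (w i)"] by (simp add: add.commute)
    \<comment> \<open>Splitting off the fraction \<open>1 - 1 / r\<close> of \<open>w i0\<close>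
      scales this vector down while \<open>z\<close> keeps its size.\<close>
    have "N (z + w i0) \<le> N (z + w i0 /\<^sub>R r) + N ((1 - 1 / r) *\<^sub>R w i0)"
      using N_add[of "z + w i0 /\<^sub>R r" "(1 - 1 / r) *\<^sub>R w i0"]
      by (simp add: algebra_simps divide_inverse)
    also have "N ((1 - 1 / r) *\<^sub>R w i0) = (1 - 1 / r) * N (w i0)"
      using r by (intro N_scale) simp
    finally have "N z + (1 / r) * N (w i0) \<le> N (z + w i0 /\<^sub>R r)"
      using sup by (simp add: algebra_simps)
    moreover have "(1 / r) * N (w i0) = N (w i0 /\<^sub>R r)"
      using r by (simp add: N_scale divide_inverse)
    moreover have "w i0 /\<^sub>R r = v i0 /\<^sub>R r + y"
      using r by (simp add: wi0 scaleR_add_right)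
    ultimately show ?thesis by simp
  qed
  have lim: "(\<lambda>n. v i0 /\<^sub>R real (Suc n) + y) \<longlonglongrightarrow> 0 *\<^sub>R v i0 + y"
    by (intro tendsto_intros LIMSEQ_inverse_real_of_nat)
  have N_tendsto: "(\<lambda>n. N (f n)) \<longlonglongrightarrow> N x" if "f \<longlonglongrightarrow> x" for f x
    using continuous_on_tendsto_compose[OF N_continuous[of UNIV] that] by simp
  have "N z + N (0 *\<^sub>R v i0 + y) \<le> N (z + (0 *\<^sub>R v i0 + y))"
    by (rule LIMSEQ_le[OF tendsto_add[OF tendsto_const N_tendsto[OF lim]]
          N_tendsto[OF tendsto_add[OF tendsto_const lim]]])
       (use ray in auto)
  then show ?thesis using N_add[of z y] by simp
qed

end

section \<open>Additivity of the gauge on blocks\<close>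

context gauge begin

lemma span_blocks:
  assumes "disjoint P" "F \<subseteq> P" "T \<in> P" "T \<notin> F"
    and "\<And>T'. T' \<in> F \<Longrightarrow> x T' \<in> span T'"
  shows "(\<Sum>T'\<in>F. x T') \<in> span (\<Union>P - T)"
proof (rule span_sum)
  fix T' assume T': "T' \<in> F"
  then have "T' \<inter> T = {}"
    using assms by (metis disjointD subsetD)
  then have "T' \<subseteq> \<Union>P - T" using T' assms(2) by blast
  then show "x T' \<in> span (\<Union>P - T)" using assms(5)[OF T'] span_mono by blast
qed

text \<open>The analytic form of the convex hull condition: for a convex \<open>K\<close> with gauge
  \<open>N\<close> the two will be shown equivalent.\<close>

definition additive_on_blocks :: "'a set set \<Rightarrow> bool" where
  "additive_on_blocks P \<longleftrightarrow>
    (\<forall>T\<in>P. \<forall>z\<in>span (\<Union>P - T). \<forall>y\<in>span T. N (z + y) = N z + N y)"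

lemma N_sum_blocks:
  assumes "additive_on_blocks P" "disjoint P" "finite F" "F \<subseteq> P"
    and "\<And>T. T \<in> F \<Longrightarrow> x T \<in> span T"
  shows "N (\<Sum>T\<in>F. x T) = (\<Sum>T\<in>F. N (x T))"
  using assms(3-5)
proof (induction F rule: finite_induct)
  case (insert T F)
  have "(\<Sum>T\<in>F. x T) \<in> span (\<Union>P - T)"
    using insert assms(2) by (intro span_blocks) auto
  then have "N ((\<Sum>T\<in>F. x T) + x T) = N (\<Sum>T\<in>F. x T) + N (x T)"
    using assms(1) insert.prems unfolding additive_on_blocks_def by auto
  then show ?case using insert by (simp add: add.commute)
qed simp

text \<open>Additivity makes \<open>exp (- N)\<close> a product over the blocks, and Tonelli's
  theorem splits the integral.\<close>

lemma marginal_blocks: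
  assumes "additive_on_blocks P" "disjoint P" "orthonormal (\<Union>P)" "finite F" "F \<subseteq> P"
  shows "marginal (\<Union>F) 0 = (\<Prod>T\<in>F. marginal T 0)"
  using assms(4,5)
proof (induction F rule: finite_induct)
  case (insert T F)
  have sub: "T \<subseteq> \<Union>P" "\<Union>F \<subseteq> \<Union>P" using insert.prems by auto
  have on: "orthonormal T" "orthonormal (\<Union>F)" "orthonormal (T \<union> \<Union>F)"
    using sub by (auto intro!: orthonormal_mono[OF assms(3)])
  have fin: "finite T" "finite (\<Union>F)" using on orthonormal_finite by auto
  have disj: "T \<inter> \<Union>F = {}"
    using assms(2) insert by (auto dest: disjointD)
  define f where "f x = ennreal (exp (- N x))" for x
  have [measurable]: "f \<in> borel_measurable borel" unfolding f_def by measurable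
  have f_add: "f (x + y) = f x * f y" if "x \<in> span (\<Union>F)" "y \<in> span T" for x y
  proof -
    have "\<Union>F \<subseteq> \<Union>P - T" using sub disj by blast
    then have "x \<in> span (\<Union>P - T)" using that(1) span_mono by blast
    then have "N (x + y) = N x + N y"
      using assms(1) insert.prems that(2) unfolding additive_on_blocks_def by auto
    then show ?thesis by (simp add: f_def ennreal_mult[symmetric] mult_exp_exp)
  qed
  have "ennreal (marginal (T \<union> \<Union>F) 0) = frame_integral (T \<union> \<Union>F) f"
    unfolding marginal_ennreal[OF on(3)] f_def by simp
  also have "\<dots> = frame_integral T (\<lambda>y. frame_integral (\<Union>F) (\<lambda>x. f (x + y)))"
    using fin disj by (intro frame_integral_Un) auto
  also have "\<dots> = frame_integral T (\<lambda>y. frame_integral (\<Union>F) f * f y)"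
  proof (rule frame_integral_cong)
    fix y assume "y \<in> span T"
    then have "frame_integral (\<Union>F) (\<lambda>x. f (x + y)) = frame_integral (\<Union>F) (\<lambda>x. f x * f y)"
      using f_add by (intro frame_integral_cong) auto
    then show "frame_integral (\<Union>F) (\<lambda>x. f (x + y)) = frame_integral (\<Union>F) f * f y"
      by (subst (asm) frame_integral_multc) auto
  qed
  also have "\<dots> = frame_integral (\<Union>F) f * frame_integral T f"
    by (rule frame_integral_cmult) measurable
  also have "\<dots> = ennreal (marginal T 0 * marginal (\<Union>F) 0)"
  proof -
    have "frame_integral R f = ennreal (marginal R 0)" if "orthonormal R" for R
      unfolding marginal_ennreal[OF that] f_def by simp
    then show ?thesis
      using marginal_pos[OF on(1), of 0] on by (simp add: ennreal_mult' mult.commute)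
  qed
  finally show ?case
    using insert marginal_pos[OF on(1), of 0] marginal_pos[OF on(2), of 0] marginal_pos[OF on(3), of 0]
    by simp
qed simp

text \<open>In a convex combination representing \<open>(z + y) /\<^sub>R r\<close> the summands
  must be the block components, and the weights bound their gauges. Conversely, the gauges of the
  block components of \<open>x\<close> serve as weights, up to the slack
  \<open>1 - N x\<close>.\<close>

lemma convex_hull_blocks_iff:
  assumes P: "disjoint P" "orthonormal (\<Union>P)" "span (\<Union>P) = UNIV" "P \<noteq> {}"
    and K: "\<And>x. x \<in> K \<longleftrightarrow> N x \<le> 1" "convex K"
  shows "K = convex hull (\<Union>T\<in>P. K \<inter> span T) \<longleftrightarrow> additive_on_blocks P"
proof -
  have finE: "finite (\<Union>P)" using P(2) by (rule orthonormal_finite)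
  then have finP: "finite P" by (rule finite_UnionD)
  have hull: "convex hull (\<Union>T\<in>P. K \<inter> span T) =
      {\<Sum>T\<in>P. c T *\<^sub>R s T | c s. (\<forall>T\<in>P. 0 \<le> c T) \<and> sum c P = 1 \<and> (\<forall>T\<in>P. s T \<in> K \<inter> span T)}"
  proof (rule convex_hull_finite_union[OF finP], intro ballI conjI)
    show "convex (K \<inter> span T)" for T
      using K(2) subspace_imp_convex[OF subspace_span] by (rule convex_Int)
    have "0 \<in> K \<inter> span T" for T using K(1) by (simp add: span_zero)
    then show "K \<inter> span T \<noteq> {}" for T by blast
  qed
  show ?thesis
  proof
    assume eq: "K = convex hull (\<Union>T\<in>P. K \<inter> span T)"
    show "additive_on_blocks P"
      unfolding additive_on_blocks_def
    proof (intro ballI)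
      fix T z y assume T: "T \<in> P" and z: "z \<in> span (\<Union>P - T)" and y: "y \<in> span T"
      have "N z + N y \<le> r" if r: "N (z + y) < r" for r
      proof -
        have r0: "0 < r" using r N_nonneg[of "z + y"] by linarith
        then have "(z + y) /\<^sub>R r \<in> convex hull (\<Union>T\<in>P. K \<inter> span T)"
          using r unfolding eq[symmetric] K(1) by (simp add: N_scale inverse_eq_divide pos_divide_le_eq)
        then obtain c s where cs: "\<And>T. T \<in> P \<Longrightarrow> 0 \<le> c T" "sum c P = 1"
            "\<And>T. T \<in> P \<Longrightarrow> s T \<in> K \<inter> span T" "(z + y) /\<^sub>R r = (\<Sum>T\<in>P. c T *\<^sub>R s T)"
          unfolding hull mem_Collect_eq by metis
        define z' where "z' = (\<Sum>T'\<in>P - {T}. c T' *\<^sub>R s T')"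
        have z': "z' \<in> span (\<Union>P - T)" unfolding z'_def
          using P(1) T cs(3) by (intro span_blocks) (auto intro: span_scale)
        have dec: "(z + y) /\<^sub>R r = c T *\<^sub>R s T + z'"
          unfolding cs(4) z'_def using finP T by (rule sum.remove)
        \<comment> \<open>The discrepancy between the two decompositions lies in two orthogonal
          subspaces and is therefore zero.\<close>
        define d where "d = y /\<^sub>R r - c T *\<^sub>R s T"
        have d: "d = z' - z /\<^sub>R r"
          using dec by (simp add: d_def scaleR_add_right algebra_simps)
        have dT: "d \<in> span T" unfolding d_def using y cs(3)[OF T] by (intro span_diff span_scale) auto
        have dT': "d \<in> span (\<Union>P - T)" unfolding d using z z' by (intro span_diff span_scale) auto
        have "orthogonal a b" if "a \<in> T" "b \<in> \<Union>P - T" for a b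
        proof -
          have "a \<in> \<Union>P" "b \<in> \<Union>P" "a \<noteq> b" using that T by auto
          then show ?thesis using P(2) by (auto simp: orthonormal_def dest: pairwiseD)
        qed
        then have "orthogonal d a" if "a \<in> T" for a
          using orthogonal_to_span[OF dT'] that orthogonal_commute by blast
        then have "orthogonal d d" by (rule orthogonal_to_span[OF dT])
        then have "d = 0" by (simp add: orthogonal_self)
        then have "y /\<^sub>R r = c T *\<^sub>R s T" "z /\<^sub>R r = z'" using d by (auto simp: d_def)
        moreover have N_s: "N (c T' *\<^sub>R s T') \<le> c T'" if "T' \<in> P" for T'
          using cs(1,3)[OF that] K(1) by (simp add: N_scale mult_left_le)
        moreover have "N z' \<le> (\<Sum>T'\<in>P - {T}. c T')"
          unfolding z'_def by (rule order_trans[OF N_sum sum_mono]) (use N_s in auto)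
        moreover have "c T + (\<Sum>T'\<in>P - {T}. c T') = 1"
          using cs(2) finP T by (simp add: sum.remove)
        ultimately have "N (y /\<^sub>R r) + N (z /\<^sub>R r) \<le> 1"
          using N_s[OF T] by simp
        then show ?thesis using r0 by (simp add: N_scale field_simps)
      qed
      then have "N z + N y \<le> N (z + y)" by (rule dense_ge)
      then show "N (z + y) = N z + N y" using N_add[of z y] by simp
    qed
  next
    assume add: "additive_on_blocks P"
    show "K = convex hull (\<Union>T\<in>P. K \<inter> span T)"
    proof
      show "convex hull (\<Union>T\<in>P. K \<inter> span T) \<subseteq> K"
        using K(2) by (intro hull_minimal) auto
      show "K \<subseteq> convex hull (\<Union>T\<in>P. K \<inter> span T)"
      proof
        fix x assume "x \<in> K"
        then have x1: "N x \<le> 1" by (simp add: K)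
        obtain a where a: "x = (\<Sum>b\<in>\<Union>P. a b *\<^sub>R b)"
        proof -
          have "x \<in> span (\<Union>P)" using P(3) by simp
          then show thesis using that unfolding span_finite[OF finE] by auto
        qed
        define X where "X T = (\<Sum>b\<in>T. a b *\<^sub>R b)" for T
        have X: "X T \<in> span T" for T unfolding X_def by (rule frame_sum_in_span)
        have xX: "x = (\<Sum>T\<in>P. X T)"
          unfolding a X_def using finE P(1)
          by (intro sum.Union_disjoint[unfolded comp_def])
             (auto intro: finite_subset[OF Union_upper] dest: disjointD)
        then have Nx: "N x = (\<Sum>T\<in>P. N (X T))"
          using N_sum_blocks[OF add P(1) finP order_refl] X by simp
        obtain T0 where T0: "T0 \<in> P" using P(4) by blast
        \<comment> \<open>The slack \<open>1 - N x\<close> goes to an arbitrary block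
          \<open>T0\<close>, so that the weights sum to exactly \<open>1\<close>.\<close>
        define c where "c T = N (X T) + (if T = T0 then 1 - N x else 0)" for T
        have c_ge: "N (X T) \<le> c T" "0 \<le> c T" for T
          using x1 N_nonneg[of "X T"] by (auto simp: c_def)
        have "sum c P = 1"
          using finP T0 by (simp add: c_def sum.distrib Nx)
        \<comment> \<open>A zero weight forces a zero component, and then the quotient is the origin
          by the convention for division by zero.\<close>
        moreover have X_eq: "X T = c T *\<^sub>R (X T /\<^sub>R c T)" for T
          using c_ge[of T] N_nonneg[of "X T"] N_eq_0D[of "X T"] by (cases "c T = 0") auto
        moreover have "X T /\<^sub>R c T \<in> K \<inter> span T" for T
        proof
          show "X T /\<^sub>R c T \<in> K"
            unfolding K(1) using c_ge[of T]
            by (cases "c T = 0") (auto simp: N_scale field_simps)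
        qed (use X in \<open>auto intro: span_scale\<close>)
        ultimately show "x \<in> convex hull (\<Union>T\<in>P. K \<inter> span T)"
          unfolding hull xX using c_ge(2)
          by (intro CollectI exI[of _ c] exI[of _ "\<lambda>T. X T /\<^sub>R c T"]) auto
      qed
    qed
  qed
qed

end

context gauge_cover begin

text \<open>Forward, the ray argument is applied to each block in turn. Backward, every marginal
  splits into block marginals, and each block lies in exactly \<open>s\<close> of the sets
  \<open>A i\<close>.\<close>

lemma tight_iff_additive:
  assumes P: "\<Union>P = E" "disjoint P" "{} \<notin> P"
    and block: "\<And>T i. T \<in> P \<Longrightarrow> i \<in> I \<Longrightarrow> T \<subseteq> A i \<or> T \<inter> A i = {}"
    and separated: "\<And>T b. T \<in> P \<Longrightarrow> b \<in> E - T \<Longrightarrow> \<exists>i\<in>I. b \<in> A i \<and> T \<inter> A i = {}"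
    and A: "\<And>i. i \<in> I \<Longrightarrow> A i \<subseteq> E"
  shows "tight E (\<lambda>_. 0) \<longleftrightarrow> additive_on_blocks P"
proof
  have meets: "{i \<in> I. T \<subseteq> A i} = {i \<in> I. b \<in> A i}" if "T \<in> P" "b \<in> T" for T b
    using block[OF that(1)] that(2) by blast
  {
    assume tight: "tight E (\<lambda>_. 0)"
    show "additive_on_blocks P"
      unfolding additive_on_blocks_def P(1)
    proof (intro ballI)
      fix T z y assume T: "T \<in> P" and zy: "z \<in> span (E - T)" "y \<in> span T"
      obtain b where b: "b \<in> T" using T P(3) by (metis ex_in_conv)
      then have "card {i \<in> I. b \<in> A i} = s" using T P(1) by (intro cover) auto
      then have "{i \<in> I. T \<subseteq> A i} \<noteq> {}"
        using s_pos unfolding meets[OF T b] by (metis card.empty less_irrefl)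
      then obtain i0 where "i0 \<in> I" "T \<subseteq> A i0" by blast
      then show "N (z + y) = N z + N y"
        using T P b zy block separated by (intro tight_imp_additive[OF tight, of T i0]) auto
    qed
  next
    assume add: "additive_on_blocks P"
    have finP: "finite P"
      using orthonormal_finite[OF E(1)] P(1) finite_UnionD by blast
    have on: "orthonormal (\<Union>P)" using E P by simp
    note prod = marginal_blocks[OF add P(2) on]
    have "(\<Prod>i\<in>I. marginal (E \<inter> A i) 0) = (\<Prod>i\<in>I. \<Prod>T\<in>{T. T \<in> P \<and> T \<subseteq> A i}. marginal T 0)"
    proof (rule prod.cong)
      fix i assume i: "i \<in> I"
      have "E \<inter> A i = \<Union>{T. T \<in> P \<and> T \<subseteq> A i}"
        using A[OF i] block[OF _ i] P(1) by blast
      then show "marginal (E \<inter> A i) 0 = (\<Prod>T\<in>{T. T \<in> P \<and> T \<subseteq> A i}. marginal T 0)"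
        using prod[of "{T. T \<in> P \<and> T \<subseteq> A i}"] finP by auto
    qed simp
    also have "\<dots> = (\<Prod>T\<in>P. \<Prod>i\<in>{i. i \<in> I \<and> T \<subseteq> A i}. marginal T 0)"
      using I finP by (rule prod.swap_restrict)
    also have "\<dots> = (\<Prod>T\<in>P. marginal T 0 ^ s)"
    proof (rule prod.cong)
      fix T assume T: "T \<in> P"
      obtain b where b: "b \<in> T" using T P(3) by (metis ex_in_conv)
      then have "card {i \<in> I. T \<subseteq> A i} = s"
        unfolding meets[OF T b] using T P(1) by (intro cover) auto
      then show "(\<Prod>i\<in>{i. i \<in> I \<and> T \<subseteq> A i}. marginal T 0) = marginal T 0 ^ s" by simp
    qed simp
    also have "\<dots> = marginal E 0 ^ s"
      using prod[OF finP order_refl] P(1) by (simp add: prod_power_distrib)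
    finally show "tight E (\<lambda>_. 0)" by (simp add: tight_def)
  }
qed

end

section \<open>The Minkowski functional of a convex body\<close>

definition minkowski_functional :: "'a::real_normed_vector set \<Rightarrow> 'a \<Rightarrow> real" where
  "minkowski_functional K x = Inf {r. 0 < r \<and> x /\<^sub>R r \<in> K}"

text \<open>\<open>K\<close> contains a ball of radius \<epsilon> and lies in one of radius
  \<open>M\<close>, whence \<open>L = 1 / \<epsilon>\<close> and \<open>c = 1 / M\<close>. To avoid
  the question whether the infimum is attained, estimates are made for all larger factors and passed
  to the limit.\<close>

lemma minkowski_functional_gauge:
  fixes K :: "'a::euclidean_space set"
  assumes "compact K" "convex K" "0 \<in> interior K"
  obtains c L where "gauge (minkowski_functional K) c L"
    and "\<And>x. x \<in> K \<longleftrightarrow> minkowski_functional K x \<le> 1"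
proof -
  let ?N = "minkowski_functional K"
  obtain \<epsilon> where \<epsilon>: "0 < \<epsilon>" "cball 0 \<epsilon> \<subseteq> K"
    using assms(3) mem_interior_cball by blast
  obtain M where M: "0 < M" "\<And>x. x \<in> K \<Longrightarrow> norm x \<le> M"
    using compact_imp_bounded[OF assms(1)] bounded_pos by blast
  have K0: "0 \<in> K" using assms(3) interior_subset by blast
  have bdd: "bdd_below {r. 0 < r \<and> x /\<^sub>R r \<in> K}" for x
    by (rule bdd_belowI[of _ 0]) auto
  have N_le: "?N x \<le> r" if "0 < r" "x /\<^sub>R r \<in> K" for x r
    unfolding minkowski_functional_def using that bdd by (intro cInf_lower) auto
  have mem: "x /\<^sub>R (norm x / \<epsilon>) \<in> K" if "x \<noteq> 0" for x
    using that \<epsilon> by (intro subsetD[OF \<epsilon>(2)]) (auto simp: field_simps)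
  have ne: "{r. 0 < r \<and> x /\<^sub>R r \<in> K} \<noteq> {}" for x
  proof (cases "x = 0")
    case True
    then show ?thesis using K0 by (auto intro: exI[of _ 1])
  next
    case False
    then show ?thesis using mem[of x] \<epsilon>(1) by (auto intro!: exI[of _ "norm x / \<epsilon>"])
  qed
  have scaled: "x /\<^sub>R r \<in> K" "0 < r" if r: "?N x < r" for x r
  proof -
    obtain q where q: "0 < q" "x /\<^sub>R q \<in> K" "q < r"
      using r cInf_less_iff[OF ne bdd] unfolding minkowski_functional_def by auto
    have "(q / r) *\<^sub>R (x /\<^sub>R q) + (1 - q / r) *\<^sub>R 0 \<in> K"
      using q by (intro convexD[OF assms(2)] q(2) K0) auto
    moreover have "(q / r) *\<^sub>R (x /\<^sub>R q) = x /\<^sub>R r"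
      using q by (simp add: field_simps)
    ultimately show "x /\<^sub>R r \<in> K" "0 < r" using q by auto
  qed
  have nonneg: "0 \<le> ?N x" for x
    unfolding minkowski_functional_def by (rule cInf_greatest[OF ne]) auto
  have add: "?N (x + y) \<le> ?N x + ?N y" for x y
  proof -
    have *: "?N (x + y) \<le> p + q" if "?N x < p" "?N y < q" for p q
    proof -
      have pq: "0 < p" "0 < q" using that nonneg[of x] nonneg[of y] by linarith+
      have "(p / (p + q)) *\<^sub>R (x /\<^sub>R p) + (q / (p + q)) *\<^sub>R (y /\<^sub>R q) \<in> K"
      proof (rule convexD[OF assms(2) scaled(1)[OF that(1)] scaled(1)[OF that(2)]])
        show "p / (p + q) + q / (p + q) = 1"
          using pq by (simp flip: add_divide_distrib)
      qed (use pq in auto)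
      moreover have eqs: "(p / (p + q)) *\<^sub>R (x /\<^sub>R p) = x /\<^sub>R (p + q)" "(q / (p + q)) *\<^sub>R (y /\<^sub>R q) = y /\<^sub>R (p + q)"
        using pq by (simp_all add: divide_inverse)
      ultimately have "(x + y) /\<^sub>R (p + q) \<in> K" by (simp only: eqs scaleR_add_right)
      then show ?thesis using pq by (intro N_le) auto
    qed
    have "?N (x + y) \<le> ?N x + ?N y + \<delta>" if "0 < \<delta>" for \<delta>
    proof -
      have "?N (x + y) \<le> (?N x + \<delta> / 2) + (?N y + \<delta> / 2)"
        using that by (intro *) auto
      then show ?thesis by simp
    qed
    then show ?thesis by (rule field_le_epsilon)
  qed
  have zero: "?N 0 = 0"
  proof -
    have "?N 0 \<le> \<delta>" if "0 < \<delta>" for \<delta> using that K0 by (intro N_le) auto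
    then show ?thesis using nonneg[of 0] by (meson dense_ge order_antisym)
  qed
  have scale_le: "?N (r *\<^sub>R x) \<le> r * ?N x" if r: "0 < r" for r x
  proof -
    have "?N (r *\<^sub>R x) / r \<le> q" if "?N x < q" for q
    proof -
      have "?N (r *\<^sub>R x) \<le> r * q"
      proof (rule N_le)
        have "inverse (r * q) * r = inverse q" using r by (simp add: field_simps)
        then show "(r *\<^sub>R x) /\<^sub>R (r * q) \<in> K"
          using scaled(1)[OF that] by (simp only: scaleR_scaleR)
      qed (use scaled(2)[OF that] r in auto)
      then show ?thesis using r by (simp add: field_simps)
    qed
    then have "?N (r *\<^sub>R x) / r \<le> ?N x" by (rule dense_ge)
    then show ?thesis using r by (simp add: field_simps)
  qed
  have scale: "?N (r *\<^sub>R x) = r * ?N x" if r: "0 \<le> r" for r x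
  proof (cases "r = 0")
    case False
    then have r: "0 < r" using r by simp
    have "?N x \<le> inverse r * ?N (r *\<^sub>R x)"
      using scale_le[of "inverse r" "r *\<^sub>R x"] r by simp
    then have "r * ?N x \<le> ?N (r *\<^sub>R x)" using r by (simp add: field_simps)
    then show ?thesis using scale_le[OF r, of x] by simp
  qed (simp add: zero)
  have lower: "norm x / M \<le> ?N x" for x
  proof (rule dense_ge)
    fix q assume q: "?N x < q"
    then show "norm x / M \<le> q"
      using M(2)[OF scaled(1)[OF q]] scaled(2)[OF q] M(1) by (simp add: field_simps)
  qed
  have upper: "?N x \<le> norm x / \<epsilon>" for x
    using N_le[OF _ mem[of x]] \<epsilon>(1) by (cases "x = 0") (auto simp: zero)
  have iff: "x \<in> K \<longleftrightarrow> ?N x \<le> 1" for x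
  proof
    show "x \<in> K \<Longrightarrow> ?N x \<le> 1" by (rule N_le) auto
  next
    assume le: "?N x \<le> 1"
    \<comment> \<open>These points of \<open>K\<close> converge to \<open>x\<close>, and
      \<open>K\<close> is closed.\<close>
    have "x /\<^sub>R (1 + inverse (real (Suc n))) \<in> K" for n
      using le by (intro scaled) (auto intro: le_less_trans)
    moreover have "(\<lambda>n. x /\<^sub>R (1 + inverse (real (Suc n)))) \<longlonglongrightarrow> x /\<^sub>R (1 + 0)"
      by (intro tendsto_intros LIMSEQ_inverse_real_of_nat) simp
    ultimately show "x \<in> K"
      using closed_sequentially[OF compact_imp_closed[OF assms(1)]] by fastforce
  qed
  have "gauge ?N (inverse M) (inverse \<epsilon>)"
    using add scale lower upper M(1) by unfold_locales (auto simp: divide_inverse mult.commute)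
  then show ?thesis using iff by (rule that)
qed

section \<open>Volumes of sections and the induced cover\<close>

text \<open>A nonempty intersection of this kind is determined by any of its points
  \<open>p\<close>, since \<open>\<epsilon> i\<close> has to record whether
  \<open>p \<in> \<sigma> i\<close>. The members are thus the equivalence classes of lying in the
  same sets.\<close>

lemma induced_cover_eq:
  "induced_cover k \<sigma> = range (\<lambda>p. {j. \<forall>i\<in>{1..k}. j \<in> \<sigma> i \<longleftrightarrow> p \<in> \<sigma> i})"
proof (intro equalityI subsetI)
  fix \<tau> assume "\<tau> \<in> induced_cover k \<sigma>"
  then obtain \<epsilon> :: "nat \<Rightarrow> nat" and p where
    \<epsilon>: "\<tau> = (\<Inter>i\<in>{1..k}. if \<epsilon> i = 0 then \<sigma> i else UNIV - \<sigma> i)" and p: "p \<in> \<tau>"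
    unfolding induced_cover_def by blast
  have side: "j \<in> \<tau> \<longleftrightarrow> (\<forall>i\<in>{1..k}. j \<in> \<sigma> i \<longleftrightarrow> \<epsilon> i = 0)" for j
    unfolding \<epsilon> by (auto split: if_splits)
  have "\<tau> = {j. \<forall>i\<in>{1..k}. j \<in> \<sigma> i \<longleftrightarrow> p \<in> \<sigma> i}"
    using p unfolding side set_eq_iff by blast
  then show "\<tau> \<in> range (\<lambda>p. {j. \<forall>i\<in>{1..k}. j \<in> \<sigma> i \<longleftrightarrow> p \<in> \<sigma> i})" by blast
next
  fix \<tau> assume "\<tau> \<in> range (\<lambda>p. {j. \<forall>i\<in>{1..k}. j \<in> \<sigma> i \<longleftrightarrow> p \<in> \<sigma> i})"
  then obtain p where p: "\<tau> = {j. \<forall>i\<in>{1..k}. j \<in> \<sigma> i \<longleftrightarrow> p \<in> \<sigma> i}" by blast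
  define \<epsilon> :: "nat \<Rightarrow> nat" where "\<epsilon> i = (if p \<in> \<sigma> i then 0 else 1)" for i
  have "\<tau> = (\<Inter>i\<in>{1..k}. if \<epsilon> i = 0 then \<sigma> i else UNIV - \<sigma> i)"
    unfolding p \<epsilon>_def by (auto split: if_splits)
  moreover have "p \<in> \<tau>" unfolding p by blast
  moreover have "\<forall>i\<in>{1..k}. \<epsilon> i \<in> {0, 1}" by (simp add: \<epsilon>_def)
  ultimately show "\<tau> \<in> induced_cover k \<sigma>" unfolding induced_cover_def by blast
qed

lemma induced_cover_partition:
  shows "\<Union>(induced_cover k \<sigma>) = UNIV" "disjoint (induced_cover k \<sigma>)" "{} \<notin> induced_cover k \<sigma>"
  unfolding induced_cover_eq disjoint_def by blast+

lemma induced_cover_block: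
  "\<tau> \<in> induced_cover k \<sigma> \<Longrightarrow> i \<in> {1..k} \<Longrightarrow> \<tau> \<subseteq> \<sigma> i \<or> \<tau> \<inter> \<sigma> i = {}"
  unfolding induced_cover_eq by blast

text \<open>As all points lie in equally many sets, a set separating two points one way
  comes with one separating them the other way.\<close>

lemma induced_cover_separated:
  assumes "uniform_cover s k \<sigma>" "\<tau> \<in> induced_cover k \<sigma>" "j \<notin> \<tau>"
  shows "\<exists>i\<in>{1..k}. j \<in> \<sigma> i \<and> \<tau> \<inter> \<sigma> i = {}"
proof -
  obtain p where p: "\<tau> = {j. \<forall>i\<in>{1..k}. j \<in> \<sigma> i \<longleftrightarrow> p \<in> \<sigma> i}"
    using assms(2) unfolding induced_cover_eq by blast
  have "card {i \<in> {1..k}. j \<in> \<sigma> i} = card {i \<in> {1..k}. p \<in> \<sigma> i}"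
    using assms(1) by (simp add: uniform_cover_def)
  moreover have "{i \<in> {1..k}. j \<in> \<sigma> i} \<noteq> {i \<in> {1..k}. p \<in> \<sigma> i}"
    using assms(3) unfolding p by blast
  ultimately have "\<not> {i \<in> {1..k}. j \<in> \<sigma> i} \<subseteq> {i \<in> {1..k}. p \<in> \<sigma> i}"
    using card_subset_eq[of "{i \<in> {1..k}. p \<in> \<sigma> i}" "{i \<in> {1..k}. j \<in> \<sigma> i}"] by auto
  then obtain i where "i \<in> {1..k}" "j \<in> \<sigma> i" "p \<notin> \<sigma> i" by blast
  moreover have "p \<in> \<tau>" unfolding p by blast
  ultimately show ?thesis using induced_cover_block[OF assms(2), of i] by blast
qed

text \<open>The section contains the origin and a small multiple of each vector in \<open>B\<close>.
  This settles the dimension in which \<open>vol\<close> measures it.\<close>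

lemma affine_hull_section:
  assumes "0 \<in> interior K" "\<And>b. b \<in> B \<Longrightarrow> norm b = 1"
  shows "affine hull (K \<inter> span B) = span B"
proof -
  obtain \<epsilon> where \<epsilon>: "0 < \<epsilon>" "cball 0 \<epsilon> \<subseteq> K"
    using assms(1) mem_interior_cball by blast
  have "0 \<in> K \<inter> span B" using \<epsilon> by (auto simp: span_zero)
  then have "affine hull (K \<inter> span B) = span (K \<inter> span B)"
    by (intro affine_hull_span_0 hull_inc)
  also have "\<dots> = span B"
  proof (rule antisym)
    show "span (K \<inter> span B) \<subseteq> span B" by (simp add: span_minimal)
    have "b \<in> span (K \<inter> span B)" if "b \<in> B" for b
    proof -
      have "\<epsilon> *\<^sub>R b \<in> cball 0 \<epsilon>" using \<epsilon>(1) assms(2)[OF that] by simp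
      then have "\<epsilon> *\<^sub>R b \<in> K \<inter> span B"
        using \<epsilon>(2) that by (auto intro: span_scale span_base)
      then have "inverse \<epsilon> *\<^sub>R (\<epsilon> *\<^sub>R b) \<in> span (K \<inter> span B)"
        by (intro span_scale span_base)
      then show ?thesis using \<epsilon>(1) by simp
    qed
    then show "span B \<subseteq> span (K \<inter> span B)" by (intro span_minimal) auto
  qed
  finally show ?thesis .
qed

lemma (in gauge) marginal_eq_vol:
  assumes "orthonormal B" and K: "\<And>x. x \<in> K \<longleftrightarrow> N x \<le> 1" "compact K" "0 \<in> interior K"
  shows "marginal B 0 = fact (card B) * vol (K \<inter> span B)"
proof -
  have "vol (K \<inter> span B) = enn2real (frame_integral B (indicator (K \<inter> span B)))"
    using assms by (intro vol_eq_frame_integral affine_hull_section)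
      (auto simp: orthonormal_def compact_imp_closed closed_Int closed_subspace)
  also have "frame_integral B (indicator (K \<inter> span B)) = frame_integral B (indicator {x. N x \<le> 1})"
    by (rule frame_integral_cong) (simp add: indicator_def K(1))
  finally show ?thesis by (simp add: marginal_origin[OF assms(1)])
qed

theorem theorem12:
  fixes e :: "'n::finite \<Rightarrow> real ^ 'n"
    and K :: "(real ^ 'n) set"
    and \<sigma> :: "nat \<Rightarrow> 'n set"
    and k s :: nat
  assumes "\<And>i j. e i \<bullet> e j = (if i = j then 1 else 0)"
    and "compact K"
    and "convex K"
    and "0 \<in> interior K"
    and "uniform_cover s k \<sigma>"
  shows "vol K ^ s =
           (\<Prod>i=1..k. fact (card (\<sigma> i))) / fact CARD('n) ^ s *
             (\<Prod>i=1..k. vol (K \<inter> coord_span e (\<sigma> i)))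
         \<longleftrightarrow>
         K = convex hull (\<Union>\<tau>\<in>induced_cover k \<sigma>. K \<inter> coord_span e \<tau>)"
proof -
  obtain c L where gauge: "gauge (minkowski_functional K) c L"
    and K: "\<And>x. x \<in> K \<longleftrightarrow> minkowski_functional K x \<le> 1"
    using minkowski_functional_gauge[OF assms(2-4)] by blast
  have inj: "inj e"
    using assms(1) by (intro injI) (metis zero_neq_one)
  have on: "orthonormal (range e)"
    unfolding orthonormal_def pairwise_def orthogonal_def using assms(1) by (auto simp: norm_eq_1)
  have "UNIV \<subseteq> span (range e)"
    using orthonormal_independent[OF on] inj by (intro card_ge_dim_independent) (auto simp: card_image)
  then have span: "span (range e) = UNIV" by blast
  \<comment> \<open>The induced cover is carried over from indices to basis vectors, where it
    partitions the frame.\<close>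
  define P where "P = (`) e ` induced_cover k \<sigma>"
  have P: "\<Union>P = range e" "disjoint P" "{} \<notin> P" "P \<noteq> {}"
  proof -
    show "\<Union>P = range e"
      unfolding P_def using induced_cover_partition(1)[of k \<sigma>] by (metis image_Union)
    show "disjoint P"
      unfolding P_def using induced_cover_partition(2)[of k \<sigma>] inj
      by (intro disjoint_image) (auto intro: inj_on_subset)
    show "{} \<notin> P"
      unfolding P_def using induced_cover_partition(3)[of k \<sigma>] by auto
    show "P \<noteq> {}" using \<open>\<Union>P = range e\<close> by auto
  qed
  have cover: "card {i \<in> {1..k}. b \<in> e ` \<sigma> i} = s" if "b \<in> range e" for b
    using that assms(5) inj by (auto simp: uniform_cover_def inj_image_mem_iff)
  have s: "0 < s" using assms(5) by (simp add: uniform_cover_def)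
  interpret gauge_cover "minkowski_functional K" c L "range e" "{1..k}" "\<lambda>i. e ` \<sigma> i" s
    using gauge on span s cover by (intro gauge_cover.intro gauge_cover_axioms.intro) auto
  have vols: "marginal (e ` \<rho>) 0 = fact (card \<rho>) * vol (K \<inter> coord_span e \<rho>)" for \<rho>
    using orthonormal_mono[OF on, of "e ` \<rho>"] inj
    by (subst marginal_eq_vol[OF _ K assms(2,4)])
       (auto simp: coord_span_def card_image inj_on_subset)
  \<comment> \<open>Clearing denominators attaches to each volume its factorial, and these products
    are the marginals at the origin.\<close>
  have "vol K ^ s = (\<Prod>i=1..k. fact (card (\<sigma> i))) / fact CARD('n) ^ s *
             (\<Prod>i=1..k. vol (K \<inter> coord_span e (\<sigma> i))) \<longleftrightarrow>
        (fact CARD('n) * vol K) ^ s = (\<Prod>i=1..k. fact (card (\<sigma> i)) * vol (K \<inter> coord_span e (\<sigma> i)))"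
    by (simp add: field_simps power_mult_distrib prod.distrib)
  also have "\<dots> \<longleftrightarrow> tight (range e) (\<lambda>_. 0)"
  proof -
    have whole: "marginal (range e) 0 = fact CARD('n) * vol K"
      using vols[of UNIV] span by (simp add: coord_span_def)
    have sub: "range e \<inter> e ` \<sigma> i = e ` \<sigma> i" for i by blast
    have "tight (range e) (\<lambda>_. 0) \<longleftrightarrow> marginal (range e) 0 ^ s = (\<Prod>i=1..k. marginal (e ` \<sigma> i) 0)"
      unfolding tight_def sub sum.neutral_const scaleR_zero_right by (rule eq_commute)
    then show ?thesis unfolding whole unfolding vols by (rule sym)
  qed
  also have "\<dots> \<longleftrightarrow> additive_on_blocks P"
  proof (rule tight_iff_additive[OF P(1-3)])
    show "T \<subseteq> e ` \<sigma> i \<or> T \<inter> e ` \<sigma> i = {}" if "T \<in> P" "i \<in> {1..k}" for T i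
    proof -
      obtain \<tau> where \<tau>: "T = e ` \<tau>" "\<tau> \<in> induced_cover k \<sigma>"
        using \<open>T \<in> P\<close> unfolding P_def by blast
      have "T \<inter> e ` \<sigma> i = e ` (\<tau> \<inter> \<sigma> i)" unfolding \<tau>(1) by (rule image_Int[OF inj, symmetric])
      then show ?thesis
        using induced_cover_block[OF \<tau>(2) that(2)] image_mono[of \<tau> "\<sigma> i" e] \<tau>(1) by auto
    qed
    show "\<exists>i\<in>{1..k}. b \<in> e ` \<sigma> i \<and> T \<inter> e ` \<sigma> i = {}" if T: "T \<in> P" and b: "b \<in> range e - T" for T b
    proof -
      obtain \<tau> j where \<tau>: "T = e ` \<tau>" "\<tau> \<in> induced_cover k \<sigma>" and j: "b = e j" "j \<notin> \<tau>"
        using T b unfolding P_def by blast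
      obtain i where "i \<in> {1..k}" "j \<in> \<sigma> i" "\<tau> \<inter> \<sigma> i = {}"
        using induced_cover_separated[OF assms(5) \<tau>(2) j(2)] by blast
      then show ?thesis
        unfolding \<tau>(1) j(1) image_Int[OF inj, symmetric] by auto
    qed
  qed auto
  also have "\<dots> \<longleftrightarrow> K = convex hull (\<Union>T\<in>P. K \<inter> span T)"
    using P on span K assms(3) by (intro convex_hull_blocks_iff[symmetric]) auto
  also have "(\<Union>T\<in>P. K \<inter> span T) = (\<Union>\<tau>\<in>induced_cover k \<sigma>. K \<inter> coord_span e \<tau>)"
    by (simp add: P_def coord_span_def)
  finally show ?thesis .
qed

end
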